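(* Let $\mathbb K$ be a field, and let $\pi:E\to\mathbb S^1$ be a fiber bundle with typical fiber $E_0$. Let $E'\subset E$ and $E_0'\subset E_0$ be subsets such that for all $p\in\mathbb S^1$ there exists a trivialization $\phi_p:\pi^{-1}\big(\mathbb S^1\setminus\{p\}\big)\to\big(\mathbb S^1\setminus\{p\}\big)\times E_0$ whose restriction to $\pi^{-1}\big(\mathbb S^1\setminus\{p\}\big)\cap E'$ gives a homeomorphism with $\big(\mathbb S^1\setminus\{p\}\big)\times E_0'$. Then, for all $k\ge0$, $$\dim\big(H_k(E,E';\mathbb K)\big)\le\dim\big(H_k(E_0,E_0';\mathbb K)\big)+\dim\big(H_{k-1}(E_0,E_0';\mathbb K)\big).$$
   Context: $H_*(\cdot,\cdot;\mathbb K)$ is relative singular homology with coefficients in $\mathbb K$, with $H_{-1}=0$; dimensions are over $\mathbb K$ and may be infinite. A trivialization over an open set $U\subset\mathbb S^1$ is a homeomorphism $\pi^{-1}(U)\to U\times E_0$ commuting with the projections onto $U$. *)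

theory Defs
  imports
    "HOL-Homology.Homology"
    "Jordan_Normal_Form.Missing_VectorSpace"
begin

unbundle cardinal_syntax

section \<open>Dimension of a vector space as a cardinal\<close>

definition field_ring :: "'k::field ring" where
  "field_ring = \<lparr>carrier = UNIV, mult = (*), one = 1, zero = 0, add = (+)\<rparr>"

text \<open>
  The dimension \<^term>\<open>vectorspace.dim\<close> is a natural number, and is meaningful only in finite
  dimension. Here the dimension is the cardinal number of a basis, finite or infinite.
\<close>

definition cardinal_dim :: "('k, 'r) ring_scheme \<Rightarrow> ('k, 'v, 'm) module_scheme \<Rightarrow> 'v rel" where
  "cardinal_dim K V = |SOME B. vectorspace.basis K V B|"

text \<open>
  The fields \<open>mult\<close> and \<open>one\<close>, which the record type of modules inherits from rings, play no role.
\<close>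

definition quotient_space :: "('k, 'v, 'm) module_scheme \<Rightarrow> 'v set \<Rightarrow> ('k, 'v set) module" where
  "quotient_space V W =
    \<lparr>carrier = a_rcosets\<^bsub>V\<^esub> W, mult = undefined, one = undefined,
     zero = W, add = set_add V,
     smult = (\<lambda>a A. \<Union>v\<in>A. W +>\<^bsub>V\<^esub> (a \<odot>\<^bsub>V\<^esub> v))\<rparr>"

section \<open>Relative singular homology with coefficients in a field\<close>

text \<open>
  The definitions mirror those of \<^theory>\<open>HOL-Homology.Simplices\<close> and
  \<^theory>\<open>HOL-Homology.Homology_Groups\<close>, with the integers replaced by a field.
\<close>

type_synonym ('k, 'a) field_chain = "((nat \<Rightarrow> real) \<Rightarrow> 'a) \<Rightarrow>\<^sub>0 'k"

definition field_chain_set :: "nat \<Rightarrow> 'a topology \<Rightarrow> ('k::field, 'a) field_chain set" where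
  "field_chain_set p X = {c. Poly_Mapping.keys c \<subseteq> singular_simplex_set p X}"

definition field_chain_scale :: "'k::field \<Rightarrow> ('k, 'a) field_chain \<Rightarrow> ('k, 'a) field_chain" where
  "field_chain_scale a c = Poly_Mapping.map ((*) a) c"

definition field_chain_boundary :: "nat \<Rightarrow> ('k::field, 'a) field_chain \<Rightarrow> ('k, 'a) field_chain" where
  "field_chain_boundary p c =
    (if p = 0 then 0
     else \<Sum>f \<in> Poly_Mapping.keys c. \<Sum>i\<le>p.
            Poly_Mapping.single (singular_face p i f) ((-1) ^ i * Poly_Mapping.lookup c f))"

definition field_relcycle_set ::
    "nat \<Rightarrow> 'a topology \<Rightarrow> 'a set \<Rightarrow> ('k::field, 'a) field_chain set" where
  "field_relcycle_set p X S =
    {c \<in> field_chain_set p X. field_chain_boundary p c \<in> field_chain_set (p - 1) (subtopology X S)}"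

definition field_relboundary_set ::
    "nat \<Rightarrow> 'a topology \<Rightarrow> 'a set \<Rightarrow> ('k::field, 'a) field_chain set" where
  "field_relboundary_set p X S =
    {c. \<exists>d \<in> field_chain_set (Suc p) X.
          field_chain_boundary (Suc p) d - c \<in> field_chain_set p (subtopology X S)}"

definition field_chain_module ::
    "('k::field, 'a) field_chain set \<Rightarrow> ('k, ('k, 'a) field_chain) module" where
  "field_chain_module Z =
    \<lparr>carrier = Z, mult = undefined, one = undefined, zero = 0, add = (+),
     smult = field_chain_scale\<rparr>"

definition relative_homology_space ::
    "'k::field itself \<Rightarrow> int \<Rightarrow> 'a topology \<Rightarrow> 'a set \<Rightarrow> ('k, ('k, 'a) field_chain set) module" where
  "relative_homology_space K p X S =
    (if p < 0 then quotient_space (field_chain_module {0}) {0}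
     else quotient_space (field_chain_module (field_relcycle_set (nat p) X S))
            (field_relboundary_set (nat p) X S))"

definition homology_dim ::
    "'k::field itself \<Rightarrow> int \<Rightarrow> 'a topology \<Rightarrow> 'a set \<Rightarrow> ('k, 'a) field_chain set rel" where
  "homology_dim K p X S = cardinal_dim (field_ring :: 'k ring) (relative_homology_space K p X S)"

section \<open>Fiber bundles\<close>

definition bundle_preimage :: "'a topology \<Rightarrow> ('a \<Rightarrow> 'c) \<Rightarrow> 'c set \<Rightarrow> 'a set" where
  "bundle_preimage E \<pi> U = {x \<in> topspace E. \<pi> x \<in> U}"

definition trivialization ::
    "'a topology \<Rightarrow> 'c topology \<Rightarrow> ('a \<Rightarrow> 'c) \<Rightarrow> 'b topology \<Rightarrow> 'c set \<Rightarrow> ('a \<Rightarrow> 'c \<times> 'b) \<Rightarrow> bool" where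
  "trivialization E B \<pi> F U \<phi> \<longleftrightarrow>
     openin B U \<and>
     homeomorphic_map (subtopology E (bundle_preimage E \<pi> U))
       (prod_topology (subtopology B U) F) \<phi> \<and>
     (\<forall>x \<in> bundle_preimage E \<pi> U. fst (\<phi> x) = \<pi> x)"

text \<open>
  Surjectivity of \<open>\<pi>\<close> is not required: it holds automatically unless the fiber is empty.
\<close>

definition fiber_bundle ::
    "'a topology \<Rightarrow> 'c topology \<Rightarrow> ('a \<Rightarrow> 'c) \<Rightarrow> 'b topology \<Rightarrow> bool" where
  "fiber_bundle E B \<pi> F \<longleftrightarrow>
     continuous_map E B \<pi> \<and>
     (\<forall>b \<in> topspace B. \<exists>U \<phi>. b \<in> U \<and> trivialization E B \<pi> F U \<phi>)"

abbreviation circle :: "complex topology" where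
  "circle \<equiv> top_of_set (sphere 0 1)"

end

theory Submission
  imports Defs "HOL-Analysis.Brouwer_Fixpoint"
begin

text \<open>
  Cover the circle by the two punctured circles \<open>U = S\<^sup>1 - {1}\<close> and \<open>V = S\<^sup>1 - {-1}\<close>, which
  meet in two open arcs \<open>W\<^sub>1\<close> and \<open>W\<^sub>2\<close>. All four sets are contractible, so over each of
  them the relative homology of the bundle pair is that of the fiber pair. After subdivision
  a relative cycle is a sum of a chain over \<open>U\<close> and a chain over \<open>V\<close>, and the boundary of
  the first one is, modulo \<open>E'\<close>, a cycle \<open>c\<^sub>1 + c\<^sub>2\<close> over the two arcs. As \<open>c\<^sub>1 + c\<^sub>2\<close>
  bounds over \<open>U\<close>, the class of \<open>c\<^sub>1\<close> determines that of \<open>c\<^sub>2\<close>; if \<open>c\<^sub>1\<close> bounds, the given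
  cycle is a sum of cycles over \<open>U\<close> and \<open>V\<close>, and both of these come from the fiber over a
  point of \<open>W\<^sub>1\<close>. Hence \<open>H\<^sub>k(E, E')\<close>, modulo the image of \<open>H\<^sub>k(E\<^sub>0, E\<^sub>0')\<close>, embeds into
  \<open>H\<^sub>k\<^sub>-\<^sub>1(E\<^sub>0, E\<^sub>0')\<close>. Subdivision and homotopy invariance over the field are obtained by
  extending integral chain operators linearly.
\<close>

text \<open>Dimensions may be infinite, so no rank count is available: the bound comes from a
  generating set of \<open>H_k(E, E')\<close> of the required cardinality. One copy of the fiber in
  degree \<open>k\<close> suffices because the pieces over both charts are moved into the same
  fiber. The monodromy of the bundle never enters: both arcs are read in the chart over
  \<open>U\<close>, and the chart over \<open>V\<close> serves only to move cycles within the part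
  over \<open>V\<close>. The obstacle is the coefficient field. Because of torsion, a cycle over a
  field need not be a combination of integral cycles, so theorems about integral homology classes
  cannot simply be tensored. What does extend are operators given on every simplex together with
  identities between them. Iterated subdivision comes with such a homotopy operator; for homotopy
  invariance one is built from acyclic models, as prisms natural in the space.\<close>

section \<open>Dimension modulo a subspace\<close>

text \<open>A basis of the quotient \<open>Z / N\<close> by representatives, so that cosets appear
  only in the comparison with \<open>cardinal_dim\<close>. The last clause also makes distinct
  elements of \<open>T\<close> incongruent modulo \<open>N\<close>.\<close>

definition basis_modulo ::
    "('k::field \<Rightarrow> 'v::ab_group_add \<Rightarrow> 'v) \<Rightarrow> 'v set \<Rightarrow> 'v set \<Rightarrow> 'v set \<Rightarrow> bool" where
  "basis_modulo s Z N T \<longleftrightarrow>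
     T \<subseteq> Z \<and> Z \<subseteq> Modules.module.span s (T \<union> N) \<and>
     (\<forall>F c. finite F \<longrightarrow> F \<subseteq> T \<longrightarrow> (\<Sum>t\<in>F. s (c t) t) \<in> N \<longrightarrow> (\<forall>t\<in>F. c t = 0))"

context vector_space
begin

text \<open>For finite \<open>G\<close> this is the exchange bound. For infinite \<open>G\<close>,
  extend \<open>S\<close> to a basis \<open>B\<close>: every \<open>s\<close> in \<open>S\<close>
  occurs in the expansion of some \<open>g\<close>, as otherwise \<open>G\<close>, and with it
  \<open>s\<close>, would lie in the span of \<open>B - {s}\<close>. So \<open>S\<close> is covered
  by \<open>|G|\<close> many finite supports.\<close>

lemma independent_card_of_le_spanning:
  assumes S: "independent S" and G: "S \<subseteq> span G"
  shows "|S| \<le>o |G|"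
proof (cases "finite G")
  case True
  then show ?thesis
    using independent_span_bound[OF True S G] by (simp add: finite_card_of_iff_card2)
next
  case False
  define B where "B = extend_basis S"
  have B: "independent B" "S \<subseteq> B" "span B = UNIV"
    using S by (simp_all add: B_def independent_extend_basis extend_basis_superset)
  define F where "F g = {b. representation B g b \<noteq> 0}" for g
  have finF: "finite (F g)" for g
    by (simp add: F_def finite_representation)
  have FB: "F g \<subseteq> B" for g
    by (auto simp: F_def intro: representation_ne_zero)
  have gF: "g \<in> span (F g)" for g
  proof -
    have "(\<Sum>b\<in>F g. scale (representation B g b) b) = g"
      using sum_nonzero_representation_eq[OF B(1), of g] B(3) by (simp add: F_def)
    moreover have "(\<Sum>b\<in>F g. scale (representation B g b) b) \<in> span (F g)"
      by (intro span_sum span_scale span_base)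
    ultimately show ?thesis by simp
  qed
  have "S \<subseteq> (\<Union>g\<in>G. F g)"
  proof
    fix s assume s: "s \<in> S"
    show "s \<in> (\<Union>g\<in>G. F g)"
    proof (rule ccontr)
      assume "s \<notin> (\<Union>g\<in>G. F g)"
      then have "F g \<subseteq> B - {s}" if "g \<in> G" for g
        using FB that by blast
      then have "G \<subseteq> span (B - {s})"
        using gF span_mono by blast
      then have "s \<in> span (B - {s})"
        using G s span_minimal[OF _ subspace_span] by blast
      then show False
        using B s unfolding dependent_def by blast
    qed
  qed
  then have "|S| \<le>o |\<Union>g\<in>G. F g|"
    by (rule card_of_mono1)
  also have "|\<Union>g\<in>G. F g| \<le>o |G|"
    using False finF
    by (intro card_of_UNION_ordLeq_infinite)
       (auto intro: ordLess_imp_ordLeq finite_ordLess_infinite2)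
  finally show ?thesis .
qed

text \<open>A linear map that kills \<open>N\<close> and fixes \<open>T\<close> reduces the claim to
  the case \<open>N = 0\<close>. It exists because \<open>T\<close> together with a basis of
  \<open>N\<close> is independent.\<close>

lemma independent_modulo_card_of_le_spanning:
  assumes N: "subspace N" and T: "T \<subseteq> span (G \<union> N)"
    and indep: "\<And>F c. finite F \<Longrightarrow> F \<subseteq> T \<Longrightarrow> (\<Sum>t\<in>F. scale (c t) t) \<in> N \<Longrightarrow> \<forall>t\<in>F. c t = 0"
  shows "|T| \<le>o |G|"
proof -
  interpret pair: vector_space_pair scale scale
    by unfold_locales
  obtain BN where BN: "BN \<subseteq> N" "independent BN" "N \<subseteq> span BN"
    using maximal_independent_subset by blast
  have TBN: "T \<inter> BN = {}"
  proof (rule ccontr)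
    assume "T \<inter> BN \<noteq> {}"
    then obtain t where "t \<in> T" "t \<in> N" using BN by blast
    then show False using indep[of "{t}" "\<lambda>_. 1"] by simp
  qed
  have ind: "independent (T \<union> BN)"
    unfolding independent_explicit_finite_subsets
  proof (intro allI impI ballI)
    fix A u v
    assume A: "A \<subseteq> T \<union> BN" "finite A" "(\<Sum>v\<in>A. scale (u v) v) = 0" and v: "v \<in> A"
    have split: "A = (A \<inter> T) \<union> (A \<inter> BN)" "(A \<inter> T) \<inter> (A \<inter> BN) = {}"
      using A TBN by auto
    have sum: "(\<Sum>v\<in>A \<inter> T. scale (u v) v) + (\<Sum>v\<in>A \<inter> BN. scale (u v) v) = 0"
      using A sum.union_disjoint[of "A \<inter> T" "A \<inter> BN" "\<lambda>v. scale (u v) v"] split by auto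
    have "(\<Sum>v\<in>A \<inter> BN. scale (u v) v) \<in> N"
      using BN N by (intro subspace_sum subspace_scale) auto
    with sum have "(\<Sum>v\<in>A \<inter> T. scale (u v) v) \<in> N"
      by (metis N add_eq_0_iff2 subspace_neg)
    then have 0: "\<forall>t\<in>A \<inter> T. u t = 0"
      using indep[of "A \<inter> T" u] A by blast
    then have "(\<Sum>v\<in>A \<inter> BN. scale (u v) v) = 0"
      using sum by simp
    then have "\<forall>t\<in>A \<inter> BN. u t = 0"
      using BN(2)[unfolded independent_explicit_finite_subsets, rule_format, of "A \<inter> BN" u] A by blast
    with 0 v split show "u v = 0" by blast
  qed
  define B where "B = extend_basis (T \<union> BN)"
  have B: "independent B" "T \<union> BN \<subseteq> B"
    using extend_basis_superset[OF ind] independent_extend_basis[OF ind] by (simp_all add: B_def)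
  \<comment> \<open>The projection along \<open>BN\<close>: basis vectors in \<open>BN\<close> go to
    zero, all others, among them those of \<open>T\<close>, stay fixed.\<close>
  define P where "P = pair.construct B (\<lambda>b. if b \<in> BN then 0 else b)"
  have linP: "Vector_Spaces.linear scale scale P"
    unfolding P_def by (rule pair.linear_construct[OF B(1)])
  have Pt: "P t = t" if "t \<in> T" for t
    using that B TBN unfolding P_def by (subst pair.construct_basis) auto
  have PBN: "P ` BN \<subseteq> {0}"
    using B unfolding P_def by (auto simp: pair.construct_basis subset_iff)
  have "P ` N \<subseteq> span (P ` BN)"
    using BN(3) pair.linear_span_image[OF linP, of BN] by blast
  also have "\<dots> \<subseteq> span {0}"
    using PBN by (rule span_mono)
  finally have PN: "P ` N \<subseteq> {0}" by simp
  have "T \<subseteq> span (P ` G)"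
  proof
    fix t assume t: "t \<in> T"
    have "P t \<in> span (P ` (G \<union> N))"
      using T t pair.linear_span_image[OF linP, of "G \<union> N"] by blast
    also have "\<dots> \<subseteq> span (insert 0 (P ` G))"
      using PN by (intro span_mono) auto
    finally show "t \<in> span (P ` G)"
      using Pt t by simp
  qed
  moreover have "independent T"
    using ind independent_mono by blast
  ultimately have "|T| \<le>o |P ` G|"
    by (intro independent_card_of_le_spanning)
  then show ?thesis
    using card_of_image ordLeq_transitive by blast
qed

text \<open>Extend a basis \<open>BN\<close> of \<open>N\<close> to a basis \<open>B\<close> of
  \<open>Z\<close>; the added vectors represent a basis of the quotient.\<close>

lemma basis_modulo_exists:
  assumes "subspace N" "subspace Z" "N \<subseteq> Z"
  obtains T where "basis_modulo scale Z N T"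
proof -
  obtain BN where BN: "BN \<subseteq> N" "independent BN" "N \<subseteq> span BN"
    using maximal_independent_subset by blast
  obtain B where B: "BN \<subseteq> B" "B \<subseteq> Z" "independent B" "Z \<subseteq> span B"
    using maximal_independent_subset_extend[of BN Z] BN assms by blast
  have "basis_modulo scale Z N (B - BN)"
    unfolding basis_modulo_def
  proof (intro conjI allI impI ballI)
    show "B - BN \<subseteq> Z" using B by blast
    have "B \<subseteq> (B - BN) \<union> N" using BN by blast
    then show "Z \<subseteq> span ((B - BN) \<union> N)"
      using B span_mono by blast
    fix F c t
    assume F: "finite F" "F \<subseteq> B - BN" "(\<Sum>t\<in>F. scale (c t) t) \<in> N" and t: "t \<in> F"
    have "(\<Sum>t\<in>F. scale (c t) t) \<in> span BN"
      using F BN by blast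
    then obtain A u where A: "finite A" "A \<subseteq> BN" "(\<Sum>t\<in>F. scale (c t) t) = (\<Sum>a\<in>A. scale (u a) a)"
      unfolding span_explicit by blast
    \<comment> \<open>Joins the combination over \<open>F\<close> and its expansion in
      \<open>BN\<close> into one vanishing combination of vectors of \<open>B\<close>.\<close>
    define w where "w x = (if x \<in> F then c x else - u x)" for x
    have disj: "F \<inter> A = {}" using F A by blast
    have "(\<Sum>x\<in>F \<union> A. scale (w x) x) = (\<Sum>x\<in>F. scale (w x) x) + (\<Sum>x\<in>A. scale (w x) x)"
      using F A disj by (intro sum.union_disjoint) auto
    also have "(\<Sum>x\<in>F. scale (w x) x) = (\<Sum>x\<in>F. scale (c x) x)"
      by (intro sum.cong) (auto simp: w_def)
    also have "(\<Sum>x\<in>A. scale (w x) x) = - (\<Sum>x\<in>A. scale (u x) x)"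
      using disj by (auto simp: w_def sum_negf[symmetric] intro!: sum.cong)
    finally have "(\<Sum>x\<in>F \<union> A. scale (w x) x) = 0"
      using A by simp
    moreover have "F \<union> A \<subseteq> B" "finite (F \<union> A)" "t \<in> F \<union> A"
      using F A B(1) t by auto
    ultimately have "w t = 0"
      using B(3) unfolding independent_explicit_finite_subsets by blast
    then show "c t = 0" using t by (simp add: w_def)
  qed
  then show thesis by (rule that)
qed

end

text \<open>The relation \<open>R\<close> plays the part of a linear map from \<open>Z\<close> to
  \<open>Z1 / N1\<close> whose kernel lies in \<open>N + i Z0\<close>. Hence
  \<open>Z / (N + i Z0)\<close> embeds into \<open>Z1 / N1\<close>, while
  \<open>(N + i Z0) / N\<close> is generated by the image of \<open>T0\<close>.\<close>

lemma card_of_basis_modulo_le_sum: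
  fixes s :: "'k::field \<Rightarrow> 'v::ab_group_add \<Rightarrow> 'v"
    and s' :: "'k \<Rightarrow> 'w::ab_group_add \<Rightarrow> 'w"
  assumes vs: "vector_space s" and vs': "vector_space s'"
    and Z: "Modules.module.subspace s Z" and N: "Modules.module.subspace s N" "N \<subseteq> Z"
    and Z0: "Modules.module.subspace s' Z0" and N1: "Modules.module.subspace s' N1"
    and T: "basis_modulo s Z N T"
    and T0: "basis_modulo s' Z0 N0 T0"
    and T1: "basis_modulo s' Z1 N1 T1"
    and i: "Vector_Spaces.linear s' s i" "i ` Z0 \<subseteq> Z" "i ` N0 \<subseteq> N"
    and R_add: "\<And>z w z' w'. R z w \<Longrightarrow> R z' w' \<Longrightarrow> R (z + z') (w + w')"
    and R_scale: "\<And>a z w. R z w \<Longrightarrow> R (s a z) (s' a w)"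
    and R_total: "\<And>z. z \<in> Z \<Longrightarrow> \<exists>w\<in>Z1. R z w"
    and R_ker: "\<And>z w. R z w \<Longrightarrow> w \<in> N1 \<Longrightarrow> \<exists>n\<in>N. \<exists>y\<in>Z0. z = n + i y"
  shows "|T| \<le>o |T0| +c |T1|"
proof -
  interpret V: vector_space s by fact
  interpret W: vector_space s' by fact
  interpret pair: vector_space_pair s' s by unfold_locales
  define M where "M = {n + y |n y. n \<in> N \<and> y \<in> i ` Z0}"
  have iZ0: "V.subspace (i ` Z0)"
    using pair.linear_subspace_image[OF i(1) Z0] .
  have subM: "V.subspace M"
    unfolding M_def using V.subspace_sums[OF N(1) iZ0] .
  have MZ: "M \<subseteq> Z"
    unfolding M_def using Z N i by (auto intro!: V.subspace_add)
  obtain T' where T': "basis_modulo s Z M T'"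
    using V.basis_modulo_exists[OF subM Z MZ] by blast
  \<comment> \<open>The chosen values need not depend linearly on \<open>z\<close>. It is enough
    that combinations of them are still related by \<open>R\<close> to the same combinations of the
    arguments.\<close>
  define w where "w z = (SOME w. w \<in> Z1 \<and> R z w)" for z
  have w: "w z \<in> Z1 \<and> R z (w z)" if "z \<in> Z" for z
    unfolding w_def by (rule someI_ex) (use R_total[OF that] in blast)
  have T'Z: "T' \<subseteq> Z" using T' by (simp add: basis_modulo_def)
  obtain w0 where "R 0 w0"
    using R_total V.subspace_0[OF Z] by blast
  then have R0: "R 0 0"
    using R_scale[of 0 w0 0] by simp
  have R_sum: "R (\<Sum>t\<in>F. s (c t) t) (\<Sum>t\<in>F. s' (c t) (w t))" if "finite F" "F \<subseteq> T'" for F c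
    using that
  proof (induction F rule: finite_induct)
    case (insert t F)
    have "R (s (c t) t) (s' (c t) (w t))"
      using insert.prems w T'Z by (intro R_scale) blast
    then show ?case using insert by (auto intro: R_add)
  qed (simp add: R0)
  have coeff0: "\<forall>t\<in>F. c t = 0"
    if F: "finite F" "F \<subseteq> T'" "(\<Sum>t\<in>F. s' (c t) (w t)) \<in> N1" for F c
  proof -
    have "(\<Sum>t\<in>F. s (c t) t) \<in> M"
      using R_ker[OF R_sum[OF F(1,2)] F(3)] unfolding M_def by blast
    then show ?thesis using T' F unfolding basis_modulo_def by blast
  qed
  \<comment> \<open>Needed to count: \<open>coeff0\<close> speaks of families indexed by
    \<open>T'\<close>, and a coincidence \<open>w a = w b\<close> would give the vanishing
    combination with coefficients 1 and -1.\<close>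
  have inj: "inj_on w T'"
  proof (rule inj_onI, rule ccontr)
    fix a b assume ab: "a \<in> T'" "b \<in> T'" "w a = w b" "a \<noteq> b"
    define c where "c t = (if t = a then 1 else -1 :: 'k)" for t
    have c: "c a = 1" "c b = -1"
      using ab by (auto simp: c_def)
    have "(\<Sum>t\<in>{a,b}. s' (c t) (w t)) = s' (c a) (w a) + s' (c b) (w b)"
      using ab(4) by simp
    also have "\<dots> = 0"
      by (simp add: c ab(3))
    finally have "(\<Sum>t\<in>{a,b}. s' (c t) (w t)) \<in> N1"
      by (simp only: W.subspace_0[OF N1])
    then have "\<forall>t\<in>{a,b}. c t = 0"
      using ab by (intro coeff0) auto
    then show False
      using c by simp
  qed
  have "|w ` T'| \<le>o |T1|"
  proof (rule W.independent_modulo_card_of_le_spanning[OF N1])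
    show "w ` T' \<subseteq> W.span (T1 \<union> N1)"
    proof -
      have "w ` T' \<subseteq> Z1"
        using w T'Z by blast
      also have "Z1 \<subseteq> W.span (T1 \<union> N1)"
        using T1 by (simp add: basis_modulo_def)
      finally show ?thesis .
    qed
    fix F c assume F: "finite F" "F \<subseteq> w ` T'" "(\<Sum>t\<in>F. s' (c t) t) \<in> N1"
    obtain F' where F': "F' \<subseteq> T'" "F = w ` F'"
      using F(2) subset_imageE by meson
    have injF: "inj_on w F'" using inj F' inj_on_subset by blast
    then have finF': "finite F'" using F F' finite_image_iff by blast
    have "(\<Sum>t\<in>F'. s' (c (w t)) (w t)) \<in> N1"
      using F(3) injF by (simp add: F' sum.reindex)
    then show "\<forall>t\<in>F. c t = 0"
      using coeff0[OF finF' F'(1), of "c \<circ> w"] F' by auto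
  qed
  moreover have "|T'| =o |w ` T'|"
    using inj card_of_ordIsoI inj_on_imp_bij_betw by blast
  ultimately have T'1: "|T'| \<le>o |T1|"
    using ordIso_ordLeq_trans by blast
  have iZ0_span: "i ` Z0 \<subseteq> V.span (i ` T0 \<union> N)"
  proof -
    have "i ` Z0 \<subseteq> i ` W.span (T0 \<union> N0)"
      using T0 by (intro image_mono) (simp add: basis_modulo_def)
    also have "\<dots> = V.span (i ` (T0 \<union> N0))"
      using pair.linear_span_image[OF i(1)] by simp
    also have "\<dots> \<subseteq> V.span (i ` T0 \<union> N)"
      using i(3) by (intro V.span_mono) auto
    finally show ?thesis .
  qed
  have "M \<subseteq> V.span (i ` T0 \<union> N)"
    unfolding M_def using iZ0_span by (auto intro!: V.span_add intro: V.span_base)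
  then have "T' \<union> M \<subseteq> V.span ((i ` T0 \<union> T') \<union> N)"
    using V.span_mono[of "i ` T0 \<union> N" "(i ` T0 \<union> T') \<union> N"] V.span_superset[of "(i ` T0 \<union> T') \<union> N"]
    by blast
  then have "V.span (T' \<union> M) \<subseteq> V.span ((i ` T0 \<union> T') \<union> N)"
    by (simp add: V.span_minimal)
  moreover have "T \<subseteq> Z" "Z \<subseteq> V.span (T' \<union> M)"
    using T T' by (simp_all add: basis_modulo_def)
  ultimately have "T \<subseteq> V.span ((i ` T0 \<union> T') \<union> N)"
    by blast
  then have "|T| \<le>o |i ` T0 \<union> T'|"
    using T by (intro V.independent_modulo_card_of_le_spanning[OF N(1)]) (auto simp: basis_modulo_def)
  also have "|i ` T0 \<union> T'| \<le>o |i ` T0| +c |T'|"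
    by (rule Un_csum)
  also have "|i ` T0| +c |T'| \<le>o |T0| +c |T1|"
    by (intro csum_mono card_of_image T'1)
  finally show ?thesis .
qed

section \<open>Bases of quotients of chain spaces\<close>

lemma lookup_field_chain_scale [simp]:
  "Poly_Mapping.lookup (field_chain_scale a c) f = a * Poly_Mapping.lookup c f"
  by (simp add: field_chain_scale_def Poly_Mapping.map.rep_eq when_def)

global_interpretation chain: vector_space "field_chain_scale :: 'k::field \<Rightarrow> ('k, 'a) field_chain \<Rightarrow> ('k, 'a) field_chain"
  by unfold_locales (auto intro!: poly_mapping_eqI simp: lookup_add algebra_simps)

lemma field_field_ring: "field (field_ring :: 'k::field ring)"
proof -
  have "\<exists>y. x * y = 1" if "x \<noteq> 0" for x :: 'k
    using that by (intro exI[of _ "inverse x"]) simp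
  moreover have "\<exists>y. y + x = 0" for x :: 'k
    by (intro exI[of _ "- x"]) simp
  ultimately show ?thesis
    by (intro cring.cring_fieldI2 cringI abelian_groupI comm_monoidI)
       (auto simp: field_ring_def algebra_simps)
qed

lemma field_ring_simps [simp]:
  "carrier (field_ring :: 'k::field ring) = UNIV"
  "\<zero>\<^bsub>(field_ring :: 'k ring)\<^esub> = 0" "\<one>\<^bsub>(field_ring :: 'k ring)\<^esub> = 1"
  "x \<oplus>\<^bsub>(field_ring :: 'k ring)\<^esub> y = x + y" "x \<otimes>\<^bsub>(field_ring :: 'k ring)\<^esub> y = x * y"
  by (simp_all add: field_ring_def)

text \<open>Relative cycles modulo relative boundaries, and zero modulo zero for negative degree,
  are the two instances.\<close>

locale chain_quotient =
  fixes Z N :: "('k::field, 'a) field_chain set"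
  assumes subspace_Z: "chain.subspace Z" and subspace_N: "chain.subspace N" and N_subset: "N \<subseteq> Z"
begin

definition Q :: "('k, ('k, 'a) field_chain set) module" where
  "Q = quotient_space (field_chain_module Z) N"

definition cls :: "('k, 'a) field_chain \<Rightarrow> ('k, 'a) field_chain set" where
  "cls v = {n + v |n. n \<in> N}"

lemma cls_eq_iff: "cls v = cls w \<longleftrightarrow> v - w \<in> N"
proof
  assume "cls v = cls w"
  moreover have "v \<in> cls v"
    using chain.subspace_0[OF subspace_N] unfolding cls_def by force
  ultimately show "v - w \<in> N" unfolding cls_def by auto
next
  have *: "cls v \<subseteq> cls w" if "v - w \<in> N" for v w
  proof
    fix x assume "x \<in> cls v"
    then obtain n where "n \<in> N" "x = (n + (v - w)) + w" unfolding cls_def by auto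
    then show "x \<in> cls w"
      using that chain.subspace_add[OF subspace_N] unfolding cls_def by blast
  qed
  assume "v - w \<in> N"
  moreover from this have "w - v \<in> N"
    using chain.subspace_neg[OF subspace_N] by fastforce
  ultimately show "cls v = cls w" using * by blast
qed

lemma carrier_Q: "carrier Q = cls ` Z"
  by (auto simp: Q_def quotient_space_def field_chain_module_def A_RCOSETS_def RCOSETS_def
      r_coset_def cls_def)

lemma zero_Q: "\<zero>\<^bsub>Q\<^esub> = cls 0"
  by (simp add: Q_def quotient_space_def cls_def)

lemma add_Q: "cls v \<oplus>\<^bsub>Q\<^esub> cls w = cls (v + w)"
proof -
  have "cls v \<oplus>\<^bsub>Q\<^esub> cls w = {x + y |x y. x \<in> cls v \<and> y \<in> cls w}"
    by (auto simp: Q_def quotient_space_def field_chain_module_def set_add_def set_mult_def)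
  also have "\<dots> = cls (v + w)"
  proof (intro equalityI subsetI)
    fix u assume "u \<in> {x + y |x y. x \<in> cls v \<and> y \<in> cls w}"
    then obtain n m where "n \<in> N" "m \<in> N" "u = (n + m) + (v + w)"
      unfolding cls_def by (auto simp: algebra_simps)
    then show "u \<in> cls (v + w)"
      using chain.subspace_add[OF subspace_N] unfolding cls_def by blast
  next
    fix u assume "u \<in> cls (v + w)"
    then obtain n where "n \<in> N" "u = (n + v) + (0 + w)"
      unfolding cls_def by (auto simp: algebra_simps)
    then show "u \<in> {x + y |x y. x \<in> cls v \<and> y \<in> cls w}"
      using chain.subspace_0[OF subspace_N] unfolding cls_def by blast
  qed
  finally show ?thesis .
qed

text \<open>The union over representatives in \<open>quotient_space\<close> collapses, because all
  of its members are one and the same coset.\<close>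

lemma smult_Q: "a \<odot>\<^bsub>Q\<^esub> cls v = cls (field_chain_scale a v)"
proof -
  have "a \<odot>\<^bsub>Q\<^esub> cls v = (\<Union>x\<in>cls v. cls (field_chain_scale a x))"
    by (auto simp: Q_def quotient_space_def field_chain_module_def a_r_coset_def r_coset_def cls_def)
  moreover have "cls (field_chain_scale a x) = cls (field_chain_scale a v)" if "x \<in> cls v" for x
  proof -
    have "x - v \<in> N"
      using that by (auto simp: cls_def)
    then show ?thesis
      using chain.subspace_scale[OF subspace_N, of "x - v" a]
      by (simp add: cls_eq_iff chain.scale_right_diff_distrib)
  qed
  moreover have "cls v \<noteq> {}"
    using chain.subspace_0[OF subspace_N] unfolding cls_def by blast
  ultimately show ?thesis by simp
qed

lemma vectorspace_Q: "vectorspace (field_ring :: 'k ring) Q"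
proof -
  have "\<exists>y\<in>cls ` Z. y \<oplus>\<^bsub>Q\<^esub> x = cls 0" if x: "x \<in> cls ` Z" for x
  proof -
    obtain v where "v \<in> Z" "x = cls v" using x by blast
    then show ?thesis
      using chain.subspace_neg[OF subspace_Z]
      by (intro bexI[of _ "cls (- v)"]) (auto simp: add_Q)
  qed
  then have "abelian_group Q"
    using chain.subspace_0[OF subspace_Z] chain.subspace_add[OF subspace_Z]
    by (intro abelian_groupI) (auto simp: carrier_Q zero_Q add_Q algebra_simps)
  then have "module (field_ring :: 'k ring) Q"
    using field_field_ring chain.subspace_scale[OF subspace_Z]
    by (intro moduleI)
       (auto simp: carrier_Q smult_Q add_Q chain.scale_left_distrib chain.scale_right_distrib
         intro: fieldE(1))
  then show ?thesis
    by (intro vectorspace.intro field_field_ring)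
qed

interpretation Q: vectorspace "field_ring :: 'k ring" Q
  by (rule vectorspace_Q)

text \<open>Injectivity of \<open>cls\<close> on \<open>A\<close> keeps the terms of different
  representatives from merging when the sum is taken over the image.\<close>

lemma lincomb_Q:
  assumes "finite A" "A \<subseteq> Z" "inj_on cls A"
  shows "Q.lincomb a (cls ` A) = cls (\<Sum>v\<in>A. field_chain_scale (a (cls v)) v)"
  using assms
proof (induction A rule: finite_induct)
  case empty
  then show ?case by (simp add: Q.lincomb_def zero_Q)
next
  case (insert v A)
  have "a x \<odot>\<^bsub>Q\<^esub> x \<in> carrier Q" if "x \<in> cls ` insert v A" for x
    using that insert.prems chain.subspace_scale[OF subspace_Z] by (auto simp: smult_Q carrier_Q)
  moreover have "cls v \<notin> cls ` A"
    using insert by (auto simp: inj_on_def)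
  ultimately have "Q.lincomb a (cls ` insert v A) = a (cls v) \<odot>\<^bsub>Q\<^esub> cls v \<oplus>\<^bsub>Q\<^esub> Q.lincomb a (cls ` A)"
    using insert.hyps(1) unfolding Q.lincomb_def image_insert by (intro Q.finsum_insert) auto
  then show ?case
    using insert by (simp add: smult_Q add_Q)
qed

text \<open>Since \<open>cls\<close> is injective on \<open>T\<close>, coefficients can be carried
  between cosets and representatives in both directions. A combination of cosets vanishes iff that
  of the representatives lies in \<open>N\<close>, and the cosets generate iff \<open>Z\<close> lies
  in \<open>span T + N\<close>.\<close>

lemma basis_cls_image_iff:
  assumes "T \<subseteq> Z" "inj_on cls T"
  shows "Q.basis (cls ` T) \<longleftrightarrow> basis_modulo field_chain_scale Z N T"
proof -
  have rep: "\<exists>F\<subseteq>T. finite F \<and> A = cls ` F \<and> inj_on cls F" if A: "finite A" "A \<subseteq> cls ` T" for A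
  proof -
    obtain F where "F \<subseteq> T" "A = cls ` F" using A(2) by (meson subset_imageE)
    moreover from this have "inj_on cls F" using assms inj_on_subset by blast
    ultimately show ?thesis using A(1) finite_image_iff by blast
  qed
  have cls0: "cls v = \<zero>\<^bsub>Q\<^esub> \<longleftrightarrow> v \<in> N" for v
    by (simp add: zero_Q cls_eq_iff)
  have "Q.lin_indpt (cls ` T) \<longleftrightarrow>
      (\<forall>F c. finite F \<longrightarrow> F \<subseteq> T \<longrightarrow> (\<Sum>t\<in>F. field_chain_scale (c t) t) \<in> N \<longrightarrow> (\<forall>t\<in>F. c t = 0))"
    (is "?L \<longleftrightarrow> ?R")
  proof
    assume L: ?L
    show ?R
    proof (intro allI impI ballI)
      fix F and c :: "('k, 'a) field_chain \<Rightarrow> 'k" and t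
      assume F: "finite F" "F \<subseteq> T" "(\<Sum>t\<in>F. field_chain_scale (c t) t) \<in> N" and t: "t \<in> F"
      have inj: "inj_on cls F" using F assms inj_on_subset by blast
      define a where "a = c \<circ> inv_into F cls"
      have a: "a (cls v) = c v" if "v \<in> F" for v
        using that inj by (simp add: a_def)
      have "Q.lincomb a (cls ` F) = cls (\<Sum>t\<in>F. field_chain_scale (c t) t)"
        using F assms inj by (subst lincomb_Q) (auto simp: a intro!: arg_cong[of _ _ cls] sum.cong)
      then have "Q.lincomb a (cls ` F) = \<zero>\<^bsub>Q\<^esub>"
        using F by (simp add: cls0)
      then have "a (cls t) = 0"
        using L F t unfolding Q.lin_dep_def by (auto simp: image_mono dest!: spec[of _ "cls ` F"])
      then show "c t = 0" using a t by simp
    qed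
  next
    assume R: ?R
    show ?L
    proof
      assume "Q.lin_dep (cls ` T)"
      then obtain A a v where A: "finite A" "A \<subseteq> cls ` T" "Q.lincomb a A = \<zero>\<^bsub>Q\<^esub>" "v \<in> A" "a v \<noteq> 0"
        unfolding Q.lin_dep_def by auto
      then obtain F where F: "F \<subseteq> T" "finite F" "A = cls ` F" "inj_on cls F"
        using rep by blast
      have "(\<Sum>t\<in>F. field_chain_scale (a (cls t)) t) \<in> N"
        using A F assms lincomb_Q[of F a] cls0 by auto
      then show False using R F A by fastforce
    qed
  qed
  moreover have "Q.gen_set (cls ` T) \<longleftrightarrow> Z \<subseteq> chain.span (T \<union> N)" (is "?L \<longleftrightarrow> ?R")
  proof -
    have "Q.span (cls ` T) = cls ` chain.span T"
    proof (intro equalityI subsetI)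
      fix x assume "x \<in> Q.span (cls ` T)"
      then obtain a A where A: "x = Q.lincomb a A" "finite A" "A \<subseteq> cls ` T"
        unfolding Q.span_def by auto
      then obtain F where F: "F \<subseteq> T" "finite F" "A = cls ` F" "inj_on cls F"
        using rep by blast
      have "x = cls (\<Sum>v\<in>F. field_chain_scale (a (cls v)) v)"
        using A F assms by (simp add: lincomb_Q)
      moreover have "(\<Sum>v\<in>F. field_chain_scale (a (cls v)) v) \<in> chain.span T"
        using F by (intro chain.span_sum chain.span_scale chain.span_base) auto
      ultimately show "x \<in> cls ` chain.span T" by blast
    next
      fix x assume "x \<in> cls ` chain.span T"
      then obtain F c where F: "finite F" "F \<subseteq> T" "x = cls (\<Sum>v\<in>F. field_chain_scale (c v) v)"
        unfolding chain.span_explicit by blast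
      have inj: "inj_on cls F" using F assms inj_on_subset by blast
      have "x = Q.lincomb (c \<circ> inv_into F cls) (cls ` F)"
        using F assms inj by (subst lincomb_Q) (auto intro!: arg_cong[of _ _ cls] sum.cong)
      then show "x \<in> Q.span (cls ` T)"
        unfolding Q.span_def using F by (intro CollectI exI[of _ "c \<circ> inv_into F cls"] exI[of _ "cls ` F"]) auto
    qed
    moreover have "chain.span T \<subseteq> Z"
      using assms subspace_Z chain.span_minimal by blast
    moreover have "cls ` Z \<subseteq> cls ` chain.span T \<longleftrightarrow> Z \<subseteq> {x + y |x y. x \<in> chain.span T \<and> y \<in> N}"
    proof -
      have "cls z \<in> cls ` chain.span T \<longleftrightarrow> (\<exists>x\<in>chain.span T. \<exists>y\<in>N. z = x + y)" for z
      proof -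
        have "cls z \<in> cls ` chain.span T \<longleftrightarrow> (\<exists>x\<in>chain.span T. z - x \<in> N)"
          by (auto simp: image_iff cls_eq_iff)
        also have "\<dots> \<longleftrightarrow> (\<exists>x\<in>chain.span T. \<exists>y\<in>N. z = x + y)"
          by (metis add_diff_cancel_left' diff_add_cancel add.commute)
        finally show ?thesis .
      qed
      then show ?thesis by blast
    qed
    moreover have "{x + y |x y. x \<in> chain.span T \<and> y \<in> N} = chain.span (T \<union> N)"
      using subspace_N by (simp add: chain.span_Un chain.span_eq_iff[THEN iffD2])
    ultimately show ?thesis
      by (auto simp: carrier_Q)
  qed
  moreover have "cls ` T \<subseteq> carrier Q"
    using assms by (auto simp: carrier_Q)
  ultimately show ?thesis
    using assms unfolding Q.basis_def basis_modulo_def by blast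
qed

text \<open>The basis in \<open>cardinal_dim\<close> is an arbitrary choice, so a basis has to be
  exhibited before anything is known about it; afterwards representatives are selected for the
  chosen one.\<close>

lemma cardinal_dim_Q:
  obtains T where "basis_modulo field_chain_scale Z N T"
    "|T| =o cardinal_dim (field_ring :: 'k ring) Q"
proof -
  obtain T0 where T0: "basis_modulo field_chain_scale Z N T0"
    using chain.basis_modulo_exists[OF subspace_N subspace_Z N_subset] .
  \<comment> \<open>Two congruent elements would give a combination in \<open>N\<close> with
    coefficients 1 and -1.\<close>
  have "inj_on cls T0"
  proof (rule inj_onI, rule ccontr)
    fix a b assume ab: "a \<in> T0" "b \<in> T0" "cls a = cls b" "a \<noteq> b"
    define c where "c t = (if t = a then 1 else -1 :: 'k)" for t
    have c: "c a = 1" "c b = -1"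
      using ab by (auto simp: c_def)
    have "(\<Sum>t\<in>{a,b}. field_chain_scale (c t) t) = field_chain_scale (c a) a + field_chain_scale (c b) b"
      using ab(4) by simp
    also have "\<dots> = a - b"
      by (simp add: c)
    finally have "(\<Sum>t\<in>{a,b}. field_chain_scale (c t) t) \<in> N"
      using ab(3) by (simp add: cls_eq_iff)
    moreover have "finite {a,b}" "{a,b} \<subseteq> T0" using ab by auto
    ultimately have "\<forall>t\<in>{a,b}. c t = 0"
      using T0 unfolding basis_modulo_def by blast
    then show False
      using c by simp
  qed
  then have "Q.basis (cls ` T0)"
    using T0 basis_cls_image_iff by (simp add: basis_modulo_def)
  then have B: "Q.basis (SOME B. Q.basis B)" (is "Q.basis ?B")
    by (rule someI)
  then have "?B \<subseteq> cls ` Z"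
    by (simp add: Q.basis_def carrier_Q)
  then obtain T where T: "T \<subseteq> Z" "inj_on cls T" "?B = cls ` T"
    by (meson subset_image_inj)
  have "|T| =o |?B|"
    using T card_of_ordIsoI by (metis inj_on_imp_bij_betw)
  then show thesis
    using that[of T] B T basis_cls_image_iff[OF T(1,2)] by (simp add: cardinal_dim_def)
qed

end

section \<open>Extension of scalars for integral chain operators\<close>

text \<open>The counterpart of \<open>frag_extend\<close> for coefficients in a field.\<close>

definition field_extend ::
    "(((nat \<Rightarrow> real) \<Rightarrow> 'a) \<Rightarrow> ('k::field, 'b) field_chain) \<Rightarrow> ('k, 'a) field_chain \<Rightarrow> ('k, 'b) field_chain"
  where "field_extend b c = (\<Sum>f\<in>Poly_Mapping.keys c. field_chain_scale (Poly_Mapping.lookup c f) (b f))"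

text \<open>Keys can disappear under addition and scaling. A common finite index set lets such sums
  be compared term by term.\<close>

lemma field_extend_superset:
  assumes "finite S" "Poly_Mapping.keys c \<subseteq> S"
  shows "field_extend b c = (\<Sum>f\<in>S. field_chain_scale (Poly_Mapping.lookup c f) (b f))"
  unfolding field_extend_def using assms
  by (intro sum.mono_neutral_left) (auto simp: in_keys_iff)

lemma linear_field_extend: "Vector_Spaces.linear field_chain_scale field_chain_scale (field_extend b)"
proof (unfold_locales, goal_cases)
  case (1 c d)
  let ?S = "Poly_Mapping.keys c \<union> Poly_Mapping.keys d"
  have "Poly_Mapping.keys (c + d) \<subseteq> ?S"
    by (rule Poly_Mapping.keys_add)
  then show ?case
    by (simp add: field_extend_superset[of ?S] lookup_add chain.scale_left_distrib sum.distrib)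
next
  case (2 a c)
  have "Poly_Mapping.keys (field_chain_scale a c) \<subseteq> Poly_Mapping.keys c"
    by (auto simp: in_keys_iff)
  then show ?case
    by (simp add: field_extend_superset[of "Poly_Mapping.keys c"] chain.scale_sum_right)
qed

lemma field_extend_single [simp]:
  "field_extend b (Poly_Mapping.single f a) = field_chain_scale a (b f)"
  by (subst field_extend_superset[of "{f}"]) auto

lemma field_chain_expansion: "field_extend (\<lambda>f. Poly_Mapping.single f 1) c = c"
proof (rule poly_mapping_eqI)
  fix g
  have "Poly_Mapping.lookup (field_extend (\<lambda>f. Poly_Mapping.single f 1) c) g
      = (\<Sum>f\<in>Poly_Mapping.keys c. if f = g then Poly_Mapping.lookup c f else 0)"
    unfolding field_extend_def lookup_sum by (intro sum.cong) (auto simp: lookup_single when_def)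
  also have "\<dots> = Poly_Mapping.lookup c g"
    by (simp add: in_keys_iff)
  finally show "Poly_Mapping.lookup (field_extend (\<lambda>f. Poly_Mapping.single f 1) c) g
      = Poly_Mapping.lookup c g" .
qed

definition of_int_chain :: "'a chain \<Rightarrow> ('k::field, 'a) field_chain" where
  "of_int_chain c = Poly_Mapping.map of_int c"

lemma lookup_of_int_chain [simp]:
  "Poly_Mapping.lookup (of_int_chain c) f = of_int (Poly_Mapping.lookup c f)"
  by (simp add: of_int_chain_def Poly_Mapping.map.rep_eq when_def)

lemma of_int_chain_simps [simp]:
  "of_int_chain 0 = 0"
  "of_int_chain (c + d) = of_int_chain c + of_int_chain d"
  "of_int_chain (c - d) = of_int_chain c - of_int_chain d"
  "of_int_chain (frag_of f) = Poly_Mapping.single f 1"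
  "of_int_chain (frag_cmul n c) = field_chain_scale (of_int n) (of_int_chain c)"
  by (auto intro!: poly_mapping_eqI simp: lookup_add lookup_minus lookup_single when_def)

lemma of_int_chain_sum: "of_int_chain (sum g I) = (\<Sum>i\<in>I. of_int_chain (g i))"
  by (induction I rule: infinite_finite_induct) auto

text \<open>
  This is \<open>T \<otimes> K\<close>. It respects composition when \<open>T\<close> is additive, so that identities between
  integral chain operators need only be known on singular simplices to hold over \<open>K\<close>.
\<close>

definition base_change :: "('a chain \<Rightarrow> 'b chain) \<Rightarrow> ('k::field, 'a) field_chain \<Rightarrow> ('k, 'b) field_chain" where
  "base_change T = field_extend (\<lambda>f. of_int_chain (T (frag_of f)))"

lemma linear_base_change: "Vector_Spaces.linear field_chain_scale field_chain_scale (base_change T)"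
  unfolding base_change_def by (rule linear_field_extend)

lemma base_change_linear_simps [simp]:
  "base_change T 0 = 0"
  "base_change T (c + d) = base_change T c + base_change T d"
  "base_change T (c - d) = base_change T c - base_change T d"
  "base_change T (- c) = - base_change T c"
  "base_change T (field_chain_scale a c) = field_chain_scale a (base_change T c)"
proof -
  interpret Vector_Spaces.linear field_chain_scale field_chain_scale "base_change T"
    by (rule linear_base_change)
  show "base_change T 0 = 0"
    "base_change T (c + d) = base_change T c + base_change T d"
    "base_change T (c - d) = base_change T c - base_change T d"
    "base_change T (- c) = - base_change T c"
    "base_change T (field_chain_scale a c) = field_chain_scale a (base_change T c)"
    by (simp_all only: zero add diff neg scale)
qed

lemma base_change_single: "base_change T (Poly_Mapping.single f 1) = of_int_chain (T (frag_of f))"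
  by (simp add: base_change_def)

text \<open>\<open>frag_induction\<close> builds integral chains from simplices by differences
  alone, so compatibility with differences is all that is asked of \<open>T\<close>.\<close>

lemma base_change_of_int_chain:
  assumes diff: "\<And>c d. T (c - d) = T c - T d"
  shows "base_change T (of_int_chain c) = of_int_chain (T c)"
proof -
  have "T 0 = 0" using diff[of 0 0] by simp
  have "Poly_Mapping.keys c \<subseteq> UNIV" by simp
  then show ?thesis
    by (induction c rule: frag_induction) (auto simp: base_change_single diff \<open>T 0 = 0\<close>)
qed

lemma base_change_cong:
  assumes "\<And>f. f \<in> Poly_Mapping.keys c \<Longrightarrow> T (frag_of f) = T' (frag_of f)"
  shows "base_change T c = base_change T' c"
  using assms by (simp add: base_change_def field_extend_def)

lemma base_change_compose:
  assumes "\<And>c d. T (c - d) = T c - T d"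
  shows "base_change T (base_change T' c) = base_change (\<lambda>x. T (T' x)) c"
proof -
  interpret Vector_Spaces.linear field_chain_scale field_chain_scale "base_change T"
    by (rule linear_base_change)
  show ?thesis
    unfolding base_change_def[of T'] base_change_def[of "\<lambda>x. T (T' x)"] field_extend_def
    by (simp add: sum base_change_of_int_chain[of T, OF assms])
qed

lemma base_change_add_fun: "base_change (\<lambda>x. T x + T' x) c = base_change T c + base_change T' c"
  by (simp add: base_change_def field_extend_def chain.scale_right_distrib sum.distrib)

lemma base_change_diff_fun: "base_change (\<lambda>x. T x - T' x) c = base_change T c - base_change T' c"
  by (simp add: base_change_def field_extend_def chain.scale_right_diff_distrib sum_subtractf)

lemma base_change_ident: "base_change (\<lambda>x. x) c = c"
  by (simp add: base_change_def field_chain_expansion)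

lemma base_change_zero_fun: "base_change (\<lambda>x. 0) c = 0"
  by (simp add: base_change_def field_extend_def)

lemma keys_base_change:
  "Poly_Mapping.keys (base_change T c) \<subseteq> (\<Union>f\<in>Poly_Mapping.keys c. Poly_Mapping.keys (T (frag_of f)))"
proof
  fix g assume "g \<in> Poly_Mapping.keys (base_change T c)"
  then have "Poly_Mapping.lookup (base_change T c) g \<noteq> 0"
    by (simp add: in_keys_iff)
  then obtain f where f: "f \<in> Poly_Mapping.keys c"
    "Poly_Mapping.lookup (field_chain_scale (Poly_Mapping.lookup c f) (of_int_chain (T (frag_of f)))) g \<noteq> 0"
    unfolding base_change_def field_extend_def lookup_sum by (rule sum.not_neutral_contains_not_neutral)
  from f(2) have "Poly_Mapping.lookup (T (frag_of f)) g \<noteq> 0"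
    by (intro notI) simp
  then have "g \<in> Poly_Mapping.keys (T (frag_of f))"
    unfolding in_keys_iff .
  with f(1) show "g \<in> (\<Union>f\<in>Poly_Mapping.keys c. Poly_Mapping.keys (T (frag_of f)))"
    by - (rule UN_I)
qed

text \<open>The signs in the boundary are integers, so the operator over the field is the scalar
  extension of the integral one. Every later identity for it is inherited through this
  equation.\<close>

lemma field_chain_boundary_eq: "field_chain_boundary p = base_change (chain_boundary p)"
proof
  fix c :: "('k::field, 'a) field_chain"
  have single: "Poly_Mapping.single g ((-1) ^ i * a) =
      field_chain_scale a (of_int_chain (frag_cmul ((-1) ^ i) (frag_of g)))"
    for g :: "(nat \<Rightarrow> real) \<Rightarrow> 'a" and a :: 'k and i
    by (intro poly_mapping_eqI) (simp add: lookup_single when_def)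
  show "field_chain_boundary p c = base_change (chain_boundary p) c"
  proof (cases "p = 0")
    case True
    then show ?thesis
      by (simp add: field_chain_boundary_def base_change_def field_extend_def chain_boundary_of)
  next
    case False
    then show ?thesis
      unfolding field_chain_boundary_def base_change_def field_extend_def chain_boundary_of
        single
      by (simp add: of_int_chain_sum chain.scale_sum_right)
  qed
qed

section \<open>Chain spaces over the field, boundaries and induced maps\<close>

lemma subspace_field_chain_set: "chain.subspace (field_chain_set p X)"
proof (rule chain.subspaceI)
  show "0 \<in> field_chain_set p X" by (simp add: field_chain_set_def)
  show "c + d \<in> field_chain_set p X" if "c \<in> field_chain_set p X" "d \<in> field_chain_set p X" for c d
    using that Poly_Mapping.keys_add[of c d] by (auto simp: field_chain_set_def)
  show "field_chain_scale a c \<in> field_chain_set p X" if "c \<in> field_chain_set p X" for a c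
  proof -
    have "Poly_Mapping.keys (field_chain_scale a c) \<subseteq> Poly_Mapping.keys c"
      by (auto simp: in_keys_iff)
    then show ?thesis
      using that by (auto simp: field_chain_set_def)
  qed
qed

lemmas field_chain_set_add = chain.subspace_add[OF subspace_field_chain_set]
  and field_chain_set_diff = chain.subspace_diff[OF subspace_field_chain_set]
  and field_chain_set_neg = chain.subspace_neg[OF subspace_field_chain_set]
  and field_chain_set_0 = chain.subspace_0[OF subspace_field_chain_set]
  and field_chain_set_scale = chain.subspace_scale[OF subspace_field_chain_set]

lemma field_chain_set_mono: "S \<subseteq> T \<Longrightarrow> c \<in> field_chain_set p (subtopology X S) \<Longrightarrow> c \<in> field_chain_set p (subtopology X T)"
  unfolding field_chain_set_def using singular_simplex_mono by blast

lemma field_chain_set_subtopologyD: "c \<in> field_chain_set p (subtopology X S) \<Longrightarrow> c \<in> field_chain_set p X"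
  unfolding field_chain_set_def using singular_simplex_subtopology by blast

lemma base_change_in_field_chain_set:
  assumes "c \<in> field_chain_set p X"
    and "\<And>f. singular_simplex p X f \<Longrightarrow> singular_chain q Y (T (frag_of f))"
  shows "base_change T c \<in> field_chain_set q Y"
  using assms keys_base_change[of T c] unfolding field_chain_set_def singular_chain_def by blast

lemma field_chain_boundary_in:
  "c \<in> field_chain_set p X \<Longrightarrow> field_chain_boundary p c \<in> field_chain_set (p - Suc 0) X"
  unfolding field_chain_boundary_eq
  by (erule base_change_in_field_chain_set) (simp add: singular_chain_boundary singular_chain_of)

lemma field_chain_boundary_boundary:
  assumes "c \<in> field_chain_set p X"
  shows "field_chain_boundary (p - Suc 0) (field_chain_boundary p c) = 0"
proof -
  have "base_change (\<lambda>x. chain_boundary (p - Suc 0) (chain_boundary p x)) c = base_change (\<lambda>x. 0) c"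
  proof (rule base_change_cong)
    fix f assume "f \<in> Poly_Mapping.keys c"
    then have "singular_chain p X (frag_of f)"
      using assms by (auto simp: field_chain_set_def singular_chain_of)
    then show "chain_boundary (p - Suc 0) (chain_boundary p (frag_of f)) = 0"
      by (rule chain_boundary_boundary)
  qed
  then show ?thesis
    by (simp add: field_chain_boundary_eq base_change_compose chain_boundary_diff base_change_zero_fun)
qed

lemmas field_chain_boundary_simps [simp] =
  base_change_linear_simps[of "chain_boundary p" for p, folded field_chain_boundary_eq]

definition field_chain_map :: "nat \<Rightarrow> ('a \<Rightarrow> 'b) \<Rightarrow> ('k::field, 'a) field_chain \<Rightarrow> ('k, 'b) field_chain" where
  "field_chain_map p g = base_change (chain_map p g)"

lemmas field_chain_map_simps [simp] =
  base_change_linear_simps[of "chain_map p g" for p g, folded field_chain_map_def]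

lemma field_chain_map_in:
  "c \<in> field_chain_set p X \<Longrightarrow> continuous_map X Y g \<Longrightarrow> field_chain_map p g c \<in> field_chain_set p Y"
  unfolding field_chain_map_def
  by (erule base_change_in_field_chain_set) (simp add: singular_chain_of singular_simplex_simplex_map)

lemma field_chain_boundary_map:
  assumes "c \<in> field_chain_set p X"
  shows "field_chain_boundary p (field_chain_map p g c) = field_chain_map (p - Suc 0) g (field_chain_boundary p c)"
proof -
  have "base_change (\<lambda>x. chain_boundary p (chain_map p g x)) c
      = base_change (\<lambda>x. chain_map (p - Suc 0) g (chain_boundary p x)) c"
  proof (rule base_change_cong)
    fix f assume "f \<in> Poly_Mapping.keys c"
    then have "singular_chain p X (frag_of f)"
      using assms by (auto simp: field_chain_set_def singular_chain_of)
    then show "chain_boundary p (chain_map p g (frag_of f))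
        = chain_map (p - Suc 0) g (chain_boundary p (frag_of f))"
      by (rule chain_boundary_chain_map)
  qed
  then show ?thesis
    by (simp add: field_chain_boundary_eq field_chain_map_def base_change_compose chain_boundary_diff chain_map_diff)
qed

lemma field_chain_map_compose:
  "field_chain_map p h (field_chain_map p g c) = field_chain_map p (h \<circ> g) c"
proof -
  have "chain_map p (h \<circ> g) = (\<lambda>x. chain_map p h (chain_map p g x))"
    by (simp add: chain_map_compose fun_eq_iff)
  then show ?thesis
    by (simp add: field_chain_map_def base_change_compose chain_map_diff)
qed

lemma field_chain_map_ident:
  assumes "c \<in> field_chain_set p X" "\<And>x. x \<in> topspace X \<Longrightarrow> g x = x"
  shows "field_chain_map p g c = c"
proof -
  have "base_change (chain_map p g) c = base_change (\<lambda>x. x) c"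
    using assms simplex_map_id_gen[of p X _ g]
    by (intro base_change_cong) (auto simp: field_chain_set_def)
  then show ?thesis
    by (simp add: field_chain_map_def base_change_ident)
qed

section \<open>Relative cycles and relative boundaries over the field\<close>

lemma field_relcycle_setD:
  assumes "c \<in> field_relcycle_set p X S"
  shows "c \<in> field_chain_set p X" "field_chain_boundary p c \<in> field_chain_set (p - Suc 0) (subtopology X S)"
  using assms by (simp_all add: field_relcycle_set_def)

lemma field_relboundary_iff:
  "c \<in> field_relboundary_set p X S \<longleftrightarrow>
     (\<exists>d\<in>field_chain_set (Suc p) X. \<exists>e\<in>field_chain_set p (subtopology X S).
        c = field_chain_boundary (Suc p) d + e)"
proof
  assume "c \<in> field_relboundary_set p X S"
  then obtain d where d: "d \<in> field_chain_set (Suc p) X"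
    "field_chain_boundary (Suc p) d - c \<in> field_chain_set p (subtopology X S)"
    by (auto simp: field_relboundary_set_def)
  then have "- (field_chain_boundary (Suc p) d - c) \<in> field_chain_set p (subtopology X S)"
    by (rule_tac field_chain_set_neg)
  moreover have "c = field_chain_boundary (Suc p) d + - (field_chain_boundary (Suc p) d - c)" by simp
  ultimately show "\<exists>d\<in>field_chain_set (Suc p) X. \<exists>e\<in>field_chain_set p (subtopology X S).
        c = field_chain_boundary (Suc p) d + e"
    using d by blast
next
  assume "\<exists>d\<in>field_chain_set (Suc p) X. \<exists>e\<in>field_chain_set p (subtopology X S).
        c = field_chain_boundary (Suc p) d + e"
  then show "c \<in> field_relboundary_set p X S"
    using field_chain_set_neg by (force simp: field_relboundary_set_def)
qed

lemma subspace_field_relcycle_set: "chain.subspace (field_relcycle_set p X S)"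
  by (rule chain.subspaceI)
     (auto simp: field_relcycle_set_def field_chain_set_0 field_chain_set_add field_chain_set_scale)

lemma subspace_field_relboundary_set:
  "chain.subspace (field_relboundary_set p X S :: ('b::field, 'a) field_chain set)"
proof (rule chain.subspaceI)
  show "0 \<in> field_relboundary_set p X S"
    unfolding field_relboundary_iff
    by (intro bexI[of _ 0]) (auto simp: field_chain_set_0)
next
  fix c c' :: "('b, 'a) field_chain"
  assume "c \<in> field_relboundary_set p X S" "c' \<in> field_relboundary_set p X S"
  then obtain d e d' e' where *:
    "d \<in> field_chain_set (Suc p) X" "e \<in> field_chain_set p (subtopology X S)"
    "d' \<in> field_chain_set (Suc p) X" "e' \<in> field_chain_set p (subtopology X S)"
    "c = field_chain_boundary (Suc p) d + e" "c' = field_chain_boundary (Suc p) d' + e'"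
    unfolding field_relboundary_iff by blast
  then have "c + c' = field_chain_boundary (Suc p) (d + d') + (e + e')"
    by simp
  with * show "c + c' \<in> field_relboundary_set p X S"
    unfolding field_relboundary_iff by (blast intro: field_chain_set_add)
next
  fix a and c :: "('b, 'a) field_chain"
  assume "c \<in> field_relboundary_set p X S"
  then obtain d e where *: "d \<in> field_chain_set (Suc p) X" "e \<in> field_chain_set p (subtopology X S)"
    "c = field_chain_boundary (Suc p) d + e"
    unfolding field_relboundary_iff by blast
  then have "field_chain_scale a c
      = field_chain_boundary (Suc p) (field_chain_scale a d) + field_chain_scale a e"
    by (simp add: chain.scale_right_distrib)
  with * show "field_chain_scale a c \<in> field_relboundary_set p X S"
    unfolding field_relboundary_iff by (blast intro: field_chain_set_scale)
qed

lemma field_relboundary_subset_relcycle: "field_relboundary_set p X S \<subseteq> field_relcycle_set p X S"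
proof
  fix c assume "c \<in> field_relboundary_set p X S"
  then obtain d e where *: "d \<in> field_chain_set (Suc p) X" "e \<in> field_chain_set p (subtopology X S)"
    "c = field_chain_boundary (Suc p) d + e"
    unfolding field_relboundary_iff by blast
  have "field_chain_boundary p c = field_chain_boundary p e"
    using field_chain_boundary_boundary[OF *(1)] *(3) by simp
  then have "field_chain_boundary p c \<in> field_chain_set (p - 1) (subtopology X S)"
    using field_chain_boundary_in[OF *(2)] by simp
  moreover have "c \<in> field_chain_set p X"
    using * field_chain_boundary_in[OF *(1)] by (auto intro!: field_chain_set_add dest: field_chain_set_subtopologyD)
  ultimately show "c \<in> field_relcycle_set p X S"
    by (simp add: field_relcycle_set_def)
qed

lemma continuous_map_subtopology_pair:
  assumes "continuous_map X Y g" "g ` (topspace X \<inter> S) \<subseteq> T"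
  shows "continuous_map (subtopology X S) (subtopology Y T) g"
  using assms by (auto simp: continuous_map_in_subtopology continuous_map_from_subtopology)

lemma field_relcycle_map:
  assumes "c \<in> field_relcycle_set p X S" "continuous_map X Y g" "g ` (topspace X \<inter> S) \<subseteq> T"
  shows "field_chain_map p g c \<in> field_relcycle_set p Y T"
proof -
  note c = field_relcycle_setD[OF assms(1)]
  have "field_chain_boundary p (field_chain_map p g c) \<in> field_chain_set (p - Suc 0) (subtopology Y T)"
    unfolding field_chain_boundary_map[OF c(1)]
    by (rule field_chain_map_in[OF c(2) continuous_map_subtopology_pair[OF assms(2,3)]])
  then show ?thesis
    using field_chain_map_in[OF c(1) assms(2)] by (simp add: field_relcycle_set_def)
qed

lemma field_relboundary_map:
  assumes "c \<in> field_relboundary_set p X S" "continuous_map X Y g" "g ` (topspace X \<inter> S) \<subseteq> T"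
  shows "field_chain_map p g c \<in> field_relboundary_set p Y T"
proof -
  obtain d e where *: "d \<in> field_chain_set (Suc p) X" "e \<in> field_chain_set p (subtopology X S)"
    "c = field_chain_boundary (Suc p) d + e"
    using assms(1) unfolding field_relboundary_iff by blast
  have "field_chain_map p g c
      = field_chain_boundary (Suc p) (field_chain_map (Suc p) g d) + field_chain_map p g e"
    using field_chain_boundary_map[OF *(1), of g] *(3) by simp
  moreover have "field_chain_map (Suc p) g d \<in> field_chain_set (Suc p) Y"
    using * assms field_chain_map_in by blast
  moreover have "field_chain_map p g e \<in> field_chain_set p (subtopology Y T)"
    using *(2) continuous_map_subtopology_pair[OF assms(2,3)] by (rule field_chain_map_in)
  ultimately show ?thesis
    unfolding field_relboundary_iff by blast
qed

section \<open>Natural prisms from acyclic models\<close>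

abbreviation simplex_space :: "nat \<Rightarrow> (nat \<Rightarrow> real) topology" where
  "simplex_space p \<equiv> subtopology (powertop_real UNIV) (standard_simplex p)"

abbreviation cylinder :: "'a topology \<Rightarrow> (real \<times> 'a) topology" where
  "cylinder X \<equiv> prod_topology (top_of_set {0..1}) X"

abbreviation identity_simplex :: "nat \<Rightarrow> (nat \<Rightarrow> real) chain" where
  "identity_simplex p \<equiv> frag_of (restrict id (standard_simplex p))"

text \<open>The straight-line contraction to a point \<open>v\<close>, which stays in the simplex by
  convexity.\<close>

lemma contractible_simplex_space: "contractible_space (simplex_space p)"
proof -
  obtain v where v: "v \<in> standard_simplex p"
    using nonempty_standard_simplex by blast
  define h where "h = (\<lambda>(t, x :: nat \<Rightarrow> real) i. (1 - t) * x i + t * v i)"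
  have comp: "continuous_map (cylinder (simplex_space p)) euclideanreal (\<lambda>z. snd z i)" for i
  proof -
    have "continuous_map (simplex_space p) euclideanreal (\<lambda>x. x i)"
      by (intro continuous_map_from_subtopology continuous_map_product_projection) simp
    then have "continuous_map (cylinder (simplex_space p)) euclideanreal ((\<lambda>x. x i) \<circ> snd)"
      by (rule continuous_map_compose[OF continuous_map_snd])
    then show ?thesis
      by (simp add: comp_def)
  qed
  have fst: "continuous_map (cylinder (simplex_space p)) euclideanreal fst"
    using continuous_map_into_fulltopology[OF continuous_map_fst] by blast
  have "continuous_map (cylinder (simplex_space p)) (powertop_real UNIV) h"
    unfolding continuous_map_componentwise_UNIV
  proof
    fix i
    have "continuous_map (cylinder (simplex_space p)) euclideanreal (\<lambda>z. (1 - fst z) * snd z i + fst z * v i)"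
      by (intro continuous_map_add continuous_map_real_mult continuous_map_diff comp fst) auto
    then show "continuous_map (cylinder (simplex_space p)) euclideanreal (\<lambda>z. h z i)"
      by (simp add: h_def case_prod_unfold)
  qed
  then have "continuous_map (cylinder (simplex_space p)) (simplex_space p) h"
    using v by (auto simp: continuous_map_in_subtopology h_def convex_standard_simplex)
  then show ?thesis
    unfolding contractible_space_def homotopic_with_def
    by (intro exI[of _ v] exI[of _ h]) (auto simp: h_def)
qed

text \<open>The identity is homotopic to a constant map, which sends the cycle into a one-point
  space. There every cycle of positive degree bounds; in degree 0 this fails, hence
  \<open>1 \<le> p\<close>.\<close>

lemma contractible_cycle_is_boundary:
  assumes X: "contractible_space X" and c: "singular_relcycle p X {} c" and p: "1 \<le> p"
  shows "singular_relboundary p X {} c"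
proof (cases "topspace X = {}")
  case True
  then have "c = 0"
    using c by (simp add: singular_cycle singular_chain_empty)
  then show ?thesis by simp
next
  case False
  then obtain a where a: "a \<in> topspace X" by blast
  then have "homotopic_with (\<lambda>x. True) X X id (\<lambda>x. a)"
    using X by (simp add: contractible_space_alt)
  \<comment> \<open>The side condition is vacuous; it gives the homotopy the shape demanded for
    pairs, here with empty subspaces.\<close>
  then have "homotopic_with (\<lambda>h. h \<in> {} \<rightarrow> {}) X X id (\<lambda>x. a)"
    by simp
  from homotopic_imp_homologous_rel_chain_maps[OF this c]
  have "singular_relboundary p X {} (c - chain_map p (\<lambda>x. a) c)"
    using c chain_map_ident[of p X c] by (simp add: homologous_rel_def singular_cycle)
  moreover have "singular_relboundary p X {} (chain_map p (\<lambda>x. a) c)"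
  proof -
    have cont: "continuous_map X (subtopology X {a}) (\<lambda>x. a)"
      using a by (simp add: continuous_map_in_subtopology)
    have "singular_relcycle p (subtopology X {a}) {} (chain_map p (\<lambda>x. a) c)"
      using singular_relcycle_chain_map[OF c cont] by simp
    moreover have "topspace (subtopology X {a}) = {a}"
      using a by auto
    ultimately have "singular_relboundary p (subtopology X {a}) {} (chain_map p (\<lambda>x. a) c)"
      using singular_boundary_eq_cycle_singleton[OF _ p] by metis
    then obtain d where d: "singular_chain (Suc p) (subtopology X {a}) d"
      "chain_boundary (Suc p) d = chain_map p (\<lambda>x. a) c"
      unfolding singular_boundary by blast
    from d(1) have "singular_chain (Suc p) X d"
      by (simp add: singular_chain_subtopology)
    with d(2) show ?thesis
      unfolding singular_boundary by blast
  qed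
  ultimately have "singular_relboundary p X {} ((c - chain_map p (\<lambda>x. a) c) + chain_map p (\<lambda>x. a) c)"
    by (rule singular_relboundary_add)
  then show ?thesis by simp
qed

section \<open>Identity simplices, cylinders and prism operators\<close>

lemma singular_chain_identity_simplex: "singular_chain p (simplex_space p) (identity_simplex p)"
proof -
  have "continuous_map (simplex_space p) (simplex_space p) (restrict id (standard_simplex p))"
    by (rule continuous_map_eq[OF continuous_map_id]) simp
  then show ?thesis
    by (simp add: singular_chain_of singular_simplex_def)
qed

lemma chain_map_chain_map: "chain_map p h (chain_map p g c) = chain_map p (h \<circ> g) c"
  by (simp add: chain_map_compose)

lemma continuous_map_prod_cylinder:
  "continuous_map X Y g \<Longrightarrow> continuous_map (cylinder X) (cylinder Y) (map_prod id g)"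
  by (simp add: continuous_map_prod_top map_prod_def)

lemma continuous_map_Pair_cylinder:
  "t \<in> {0..1} \<Longrightarrow> continuous_map X (cylinder X) (Pair t)"
  by (simp add: continuous_map_pairwise comp_def)

text \<open>Naturality forces this form: an operator that commutes with continuous maps is
  determined by its value \<open>e\<close> on the identity simplex.\<close>

definition prism_extend ::
    "nat \<Rightarrow> (real \<times> (nat \<Rightarrow> real)) chain \<Rightarrow> 'a chain \<Rightarrow> (real \<times> 'a) chain" where
  "prism_extend q e = frag_extend (\<lambda>f. chain_map (Suc q) (map_prod id f) e)"

lemma prism_extend_diff: "prism_extend q e (c - d) = prism_extend q e c - prism_extend q e d"
  by (simp add: prism_extend_def frag_extend_diff)

lemma prism_extend_0 [simp]: "prism_extend q e 0 = 0"
  by (simp add: prism_extend_def)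

lemma singular_chain_prism_extend:
  assumes e: "singular_chain (Suc q) (cylinder (simplex_space q)) e" and c: "singular_chain q X c"
  shows "singular_chain (Suc q) (cylinder X) (prism_extend q e c)"
  unfolding prism_extend_def
proof (rule singular_chain_extend)
  fix f assume "f \<in> Poly_Mapping.keys c"
  then have "continuous_map (simplex_space q) X f"
    using c by (auto simp: singular_chain_def singular_simplex_def)
  then show "singular_chain (Suc q) (cylinder X) (chain_map (Suc q) (map_prod id f) e)"
    using e by (intro singular_chain_chain_map[OF e] continuous_map_prod_cylinder)
qed

text \<open>Naturality of the prism operator. Mapping a simplex restricts the composite to the
  standard simplex, so the two transporting maps agree only on the cylinder over it; that is why
  \<open>e\<close> must be a chain there.\<close>

lemma chain_map_prism_extend:
  assumes e: "singular_chain (Suc q) (cylinder (simplex_space q)) e"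
  shows "chain_map (Suc q) (map_prod id g) (prism_extend q e c) = prism_extend q e (chain_map q g c)"
proof -
  have "Poly_Mapping.keys c \<subseteq> UNIV" by simp
  then show ?thesis
  proof (induction c rule: frag_induction)
    case (one f)
    have "chain_map (Suc q) (map_prod id g) (chain_map (Suc q) (map_prod id f) e)
        = chain_map (Suc q) (map_prod id g \<circ> map_prod id f) e"
      by (rule chain_map_chain_map)
    also have "\<dots> = chain_map (Suc q) (map_prod id (simplex_map q g f)) e"
      by (rule chain_map_eq[OF e]) (auto simp: simplex_map_def)
    finally show ?case
      unfolding prism_extend_def frag_extend_of chain_map_of .
  qed (simp_all add: prism_extend_diff chain_map_diff)
qed

text \<open>
  Here \<open>e\<close> stands for the prism over the standard simplex and \<open>e'\<close> for the one a dimension lower; for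
  \<open>p = 0\<close> the last term vanishes whatever \<open>e'\<close> is. Given \<open>e'\<close>, the right-hand side is a cycle in a
  contractible space, which is why \<open>e\<close> exists.
\<close>

definition is_prism :: "nat \<Rightarrow> (real \<times> (nat \<Rightarrow> real)) chain \<Rightarrow> (real \<times> (nat \<Rightarrow> real)) chain \<Rightarrow> bool" where
  "is_prism p e' e \<longleftrightarrow> singular_chain (Suc p) (cylinder (simplex_space p)) e \<and>
     chain_boundary (Suc p) e =
       chain_map p (Pair 1) (identity_simplex p) - chain_map p (Pair 0) (identity_simplex p)
       - prism_extend (p - Suc 0) e' (chain_boundary p (identity_simplex p))"

text \<open>On a simplex \<open>f\<close> the formula is the model identity in
  \<open>is_prism\<close> pushed forward along \<open>map_prod id f\<close>.\<close>

lemma chain_boundary_prism_extend: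
  assumes e: "is_prism p e' e"
    and e': "p \<noteq> 0 \<Longrightarrow> singular_chain p (cylinder (simplex_space (p - Suc 0))) e'"
    and c: "singular_chain p X c"
  shows "chain_boundary (Suc p) (prism_extend p e c) + prism_extend (p - Suc 0) e' (chain_boundary p c)
       = chain_map p (Pair 1) c - chain_map p (Pair 0) c"
  using c unfolding singular_chain_def
proof (induction c rule: frag_induction)
  case (one f)
  then have f: "singular_simplex p X f" by simp
  have ce: "singular_chain (Suc p) (cylinder (simplex_space p)) e"
    using e by (simp add: is_prism_def)
  let ?F = "chain_map p (map_prod id f :: real \<times> _ \<Rightarrow> real \<times> _)"
  have Pair: "?F (chain_map p (Pair t) (identity_simplex p)) = chain_map p (Pair t) (frag_of f)" for t
  proof -
    have "?F (chain_map p (Pair t) (identity_simplex p))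
        = chain_map p (map_prod id f \<circ> Pair t) (identity_simplex p)"
      by (rule chain_map_chain_map)
    also have "map_prod id f \<circ> Pair t = Pair t \<circ> f"
      by (simp add: fun_eq_iff)
    also have "chain_map p (Pair t \<circ> f) (identity_simplex p)
        = chain_map p (Pair t) (chain_map p f (identity_simplex p))"
      by (rule chain_map_chain_map[symmetric])
    also have "\<dots> = chain_map p (Pair t) (frag_of f)"
      unfolding singular_simplex_chain_map_id[OF f] ..
    finally show ?thesis .
  qed
  \<comment> \<open>Naturality of the prism one dimension lower, combined with the fact that chain
    maps commute with boundaries.\<close>
  have ext: "?F (prism_extend (p - Suc 0) e' (chain_boundary p (identity_simplex p)))
      = prism_extend (p - Suc 0) e' (chain_boundary p (frag_of f))"
  proof (cases "p = 0")
    case True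
    then show ?thesis by (simp add: chain_boundary_def)
  next
    case False
    then have "?F (prism_extend (p - Suc 0) e' (chain_boundary p (identity_simplex p)))
      = prism_extend (p - Suc 0) e' (chain_map (p - Suc 0) f (chain_boundary p (identity_simplex p)))"
      using chain_map_prism_extend[of "p - Suc 0" e' f] e' by simp
    also have "chain_map (p - Suc 0) f (chain_boundary p (identity_simplex p))
      = chain_boundary p (chain_map p f (identity_simplex p))"
      using chain_boundary_chain_map[OF singular_chain_identity_simplex] by metis
    also have "\<dots> = chain_boundary p (frag_of f)"
      unfolding singular_simplex_chain_map_id[OF f] ..
    finally show ?thesis .
  qed
  have "chain_boundary (Suc p) (prism_extend p e (frag_of f))
      = chain_boundary (Suc p) (chain_map (Suc p) (map_prod id f) e)"
    by (simp add: prism_extend_def)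
  also have "\<dots> = ?F (chain_boundary (Suc p) e)"
    using chain_boundary_chain_map[OF ce] by simp
  also have "\<dots> = chain_map p (Pair 1) (frag_of f) - chain_map p (Pair 0) (frag_of f)
      - prism_extend (p - Suc 0) e' (chain_boundary p (frag_of f))"
    using e unfolding is_prism_def by (simp only: chain_map_diff Pair ext)
  finally show ?case by simp
next
  case (diff a b)
  then show ?case
    by (simp add: prism_extend_diff chain_boundary_diff chain_map_diff algebra_simps)
qed simp

text \<open>The required right-hand side is a cycle by the homotopy formula one dimension lower,
  applied to the boundary of the identity simplex: the correction term there involves a double
  boundary and drops out. Its degree is \<open>Suc p\<close>, so contractibility of the cylinder
  provides \<open>e\<close>.\<close>

lemma is_prism_step:
  assumes e: "is_prism p e'' e'"
    and e'': "p \<noteq> 0 \<Longrightarrow> singular_chain p (cylinder (simplex_space (p - Suc 0))) e''"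
  shows "\<exists>e. is_prism (Suc p) e' e"
proof -
  let ?X = "simplex_space (Suc p)"
  let ?i = "identity_simplex (Suc p)"
  let ?r = "chain_map (Suc p) (Pair 1) ?i - chain_map (Suc p) (Pair 0) ?i
       - prism_extend p e' (chain_boundary (Suc p) ?i)"
  have i: "singular_chain (Suc p) ?X ?i"
    by (rule singular_chain_identity_simplex)
  then have bi: "singular_chain p ?X (chain_boundary (Suc p) ?i)"
    by (rule singular_chain_boundary_alt)
  have ce': "singular_chain (Suc p) (cylinder (simplex_space p)) e'"
    using e by (simp add: is_prism_def)
  have chain: "singular_chain (Suc p) (cylinder ?X) ?r"
    using i bi ce'
    by (intro singular_chain_diff singular_chain_prism_extend singular_chain_chain_map[OF i]
        continuous_map_Pair_cylinder) auto
  have bb: "chain_boundary p (chain_boundary (Suc p) ?i) = 0"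
    using chain_boundary_boundary[OF i] by simp
  have "chain_boundary (Suc p) (prism_extend p e' (chain_boundary (Suc p) ?i))
      = chain_map p (Pair 1) (chain_boundary (Suc p) ?i) - chain_map p (Pair 0) (chain_boundary (Suc p) ?i)"
    using chain_boundary_prism_extend[OF e e'' bi] bb by simp
  then have "chain_boundary (Suc p) ?r = 0"
    using chain_boundary_chain_map[OF i, of "Pair (1::real)"] chain_boundary_chain_map[OF i, of "Pair (0::real)"]
    by (simp add: chain_boundary_diff del: chain_map_of)
  then have cyc: "singular_relcycle (Suc p) (cylinder ?X) {} ?r"
    using chain by (simp add: singular_cycle)
  have "contractible_space (cylinder ?X)"
    by (simp add: contractible_space_prod_topology contractible_simplex_space convex_imp_contractible)
  from contractible_cycle_is_boundary[OF this cyc]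
  obtain e where "singular_chain (Suc (Suc p)) (cylinder ?X) e" "chain_boundary (Suc (Suc p)) e = ?r"
    by (auto simp: singular_boundary)
  then show ?thesis
    by (auto simp: is_prism_def)
qed

text \<open>In degree 0 contractibility does not make cycles bound. Instead the two ends are
  homologous because the inclusions of bottom and top are homotopic.\<close>

lemma is_prism_0: "\<exists>e. is_prism 0 0 e"
proof -
  have "homotopic_with (\<lambda>h. h \<in> {} \<rightarrow> {}) (simplex_space 0) (cylinder (simplex_space 0)) (Pair 0) (Pair 1)"
    \<comment> \<open>The identity of the cylinder is itself a homotopy from \<open>Pair 0\<close>
      to \<open>Pair 1\<close>.\<close>
    unfolding homotopic_with_def by (intro exI[of _ id]) auto
  moreover have "singular_relcycle 0 (simplex_space 0) {} (identity_simplex 0)"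
    using singular_chain_identity_simplex[of 0] by (simp add: singular_cycle chain_boundary_def)
  ultimately have "homologous_rel 0 (cylinder (simplex_space 0)) {}
      (chain_map 0 (Pair 0) (identity_simplex 0)) (chain_map 0 (Pair 1) (identity_simplex 0))"
    by (rule homotopic_imp_homologous_rel_chain_maps)
  then have "homologous_rel 0 (cylinder (simplex_space 0)) {}
      (chain_map 0 (Pair 1) (identity_simplex 0)) (chain_map 0 (Pair 0) (identity_simplex 0))"
    by (simp only: homologous_rel_sym)
  then show ?thesis
    by (auto simp: homologous_rel_def singular_boundary is_prism_def chain_boundary_def)
qed

lemma natural_prisms_exist:
  obtains e where "is_prism 0 0 (e 0)" "\<And>p. is_prism (Suc p) (e p) (e (Suc p))"
proof -
  define e where "e = rec_nat (SOME e. is_prism 0 0 e) (\<lambda>p e'. SOME e. is_prism (Suc p) e' e)"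
  have e_Suc: "e (Suc p) = (SOME e'. is_prism (Suc p) (e p) e')" for p
    by (simp add: e_def)
  have base: "is_prism 0 0 (e 0)"
    using is_prism_0 someI_ex[of "is_prism 0 0"] by (simp add: e_def)
  \<comment> \<open>The second conjunct carries the chain hypothesis that
    \<open>is_prism_step\<close> asks for in the next round.\<close>
  have step: "is_prism (Suc p) (e p) (e (Suc p)) \<and>
      singular_chain (Suc p) (cylinder (simplex_space p)) (e p)" for p
  proof (induction p)
    case 0
    have "\<exists>e'. is_prism (Suc 0) (e 0) e'"
      by (rule is_prism_step[OF base]) simp
    then have "is_prism (Suc 0) (e 0) (e (Suc 0))"
      unfolding e_Suc by (rule someI_ex)
    then show ?case
      using base unfolding is_prism_def[of 0] by blast
  next
    case (Suc p)
    have "\<exists>e'. is_prism (Suc (Suc p)) (e (Suc p)) e'"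
      by (rule is_prism_step[OF conjunct1[OF Suc]]) (use Suc in simp)
    then have "is_prism (Suc (Suc p)) (e (Suc p)) (e (Suc (Suc p)))"
      unfolding e_Suc[of "Suc p"] by (rule someI_ex)
    then show ?case
      using Suc unfolding is_prism_def[of "Suc p"] by blast
  qed
  show thesis
    using that[of e] base step by blast
qed

section \<open>Chain homotopies over a field\<close>

text \<open>The passage from integral operators to the field, used for subdivision and for
  homotopies. The identity is needed on simplices only; \<open>H'\<close> has to respect the
  subspaces so that its value on the boundary of a relative cycle is negligible.\<close>

lemma base_change_chain_homotopy:
  assumes H: "\<And>c d. H' (c - d) = H' c - H' d"
    and H_chain: "\<And>f. singular_simplex p X f \<Longrightarrow> singular_chain (Suc p) Y (H (frag_of f))"
    and H'_chain: "\<And>f. p \<noteq> 0 \<Longrightarrow> singular_simplex (p - Suc 0) (subtopology X S) f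
      \<Longrightarrow> singular_chain p (subtopology Y T) (H' (frag_of f))"
    and homotopy: "\<And>f. singular_simplex p X f \<Longrightarrow>
      chain_boundary (Suc p) (H (frag_of f)) + H' (chain_boundary p (frag_of f)) = A (frag_of f) - B (frag_of f)"
    and c: "c \<in> field_relcycle_set p X S"
  shows "base_change A c - base_change B c \<in> field_relboundary_set p Y T"
proof -
  note cX = field_relcycle_setD[OF c]
  have "base_change (\<lambda>x. chain_boundary (Suc p) (H x) + H' (chain_boundary p x)) c
      = base_change (\<lambda>x. A x - B x) c"
    using cX(1) by (intro base_change_cong homotopy) (auto simp: field_chain_set_def)
  then have "base_change A c - base_change B c
      = field_chain_boundary (Suc p) (base_change H c) + base_change H' (field_chain_boundary p c)"
    by (simp add: base_change_add_fun base_change_diff_fun base_change_compose[OF chain_boundary_diff]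
        base_change_compose[OF H] field_chain_boundary_eq)
  moreover have "base_change H c \<in> field_chain_set (Suc p) Y"
    using cX(1) H_chain by (rule base_change_in_field_chain_set)
  moreover have "base_change H' (field_chain_boundary p c) \<in> field_chain_set p (subtopology Y T)"
  \<comment> \<open>For \<open>p = 0\<close> truncated subtraction would give \<open>H'\<close> the
    wrong degree, but there the boundary vanishes.\<close>
  proof (cases "p = 0")
    case True
    then show ?thesis
      by (simp add: field_chain_boundary_def field_chain_set_0)
  next
    case False
    then show ?thesis
      using cX(2) H'_chain by (intro base_change_in_field_chain_set) auto
  qed
  ultimately show ?thesis
    unfolding field_relboundary_iff by blast
qed

text \<open>The homotopy operator is the natural prism followed by the map induced by
  \<open>h\<close>; the ends of the cylinder yield \<open>f\<close> and \<open>g\<close>.\<close>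

theorem homotopic_imp_field_relboundary:
  assumes hom: "homotopic_with (\<lambda>h. h \<in> T \<rightarrow> V) X Y f g"
    and c: "c \<in> field_relcycle_set p X T"
  shows "field_chain_map p g c - field_chain_map p f c \<in> field_relboundary_set p Y V"
proof -
  obtain h where h: "continuous_map (cylinder X) Y h"
    and h0: "\<And>x. h (0, x) = f x" and h1: "\<And>x. h (1, x) = g x"
    and hV: "\<And>t x. t \<in> {0..1} \<Longrightarrow> x \<in> T \<Longrightarrow> h (t, x) \<in> V"
    using hom unfolding homotopic_with_def by blast
  obtain e where e: "is_prism 0 0 (e 0)" "\<And>p. is_prism (Suc p) (e p) (e (Suc p))"
    by (rule natural_prisms_exist) (rule that)
  \<comment> \<open>Degree 0 has no lower prism; the value 0 matches the placeholder in
    \<open>is_prism 0 0\<close>.\<close>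
  define e' where "e' = (case p of 0 \<Rightarrow> 0 | Suc q \<Rightarrow> e q)"
  have prism: "is_prism p e' (e p)"
    using e by (cases p) (simp_all add: e'_def)
  have e_chain: "singular_chain (Suc q) (cylinder (simplex_space q)) (e q)" for q
    using e by (cases q) (simp_all add: is_prism_def)
  have e'_chain: "singular_chain p (cylinder (simplex_space (p - Suc 0))) e'" if "p \<noteq> 0"
    using that e_chain by (cases p) (simp_all add: e'_def)
  \<comment> \<open>On the part of the cylinder over \<open>T\<close> the homotopy takes values in
    \<open>V\<close>, so the prism over the boundary of a relative cycle stays in the
    subspace.\<close>
  have hT: "continuous_map (cylinder (subtopology X T)) (subtopology Y V) h"
  proof -
    have "cylinder (subtopology X T) = subtopology (cylinder X) ({0..1} \<times> T)"
      by (simp add: prod_topology_subtopology subtopology_subtopology)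
    then show ?thesis
      using h hV by (auto intro!: continuous_map_subtopology_pair)
  qed
  show ?thesis
    unfolding field_chain_map_def
  proof (rule base_change_chain_homotopy[OF _ _ _ _ c])
    show "chain_map p h (prism_extend (p - Suc 0) e' (c - d)) =
        chain_map p h (prism_extend (p - Suc 0) e' c) - chain_map p h (prism_extend (p - Suc 0) e' d)" for c d
      by (simp add: prism_extend_diff chain_map_diff)
    show "singular_chain (Suc p) Y (chain_map (Suc p) h (prism_extend p (e p) (frag_of s)))"
      if "singular_simplex p X s" for s
      using that e_chain by (intro singular_chain_chain_map[OF _ h] singular_chain_prism_extend)
        (simp_all add: singular_chain_of)
    show "singular_chain p (subtopology Y V) (chain_map p h (prism_extend (p - Suc 0) e' (frag_of s)))"
      if "p \<noteq> 0" "singular_simplex (p - Suc 0) (subtopology X T) s" for s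
      using that singular_chain_prism_extend[of "p - Suc 0" e' "subtopology X T" "frag_of s"] e'_chain
      by (intro singular_chain_chain_map[OF _ hT]) (simp add: singular_chain_of)
  next
    fix s assume s: "singular_simplex p X s"
    then have sc: "singular_chain p X (frag_of s)" by (simp add: singular_chain_of)
    let ?P = "prism_extend p (e p) (frag_of s)"
    have Pchain: "singular_chain (Suc p) (cylinder X) ?P"
      by (rule singular_chain_prism_extend[OF e_chain sc])
    have bd: "chain_boundary (Suc p) ?P + prism_extend (p - Suc 0) e' (chain_boundary p (frag_of s))
        = chain_map p (Pair 1) (frag_of s) - chain_map p (Pair 0) (frag_of s)"
      using prism e'_chain sc by (rule chain_boundary_prism_extend)
    have "chain_boundary (Suc p) (chain_map (Suc p) h ?P)
        + chain_map p h (prism_extend (p - Suc 0) e' (chain_boundary p (frag_of s)))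
        = chain_map p h (chain_boundary (Suc p) ?P + prism_extend (p - Suc 0) e' (chain_boundary p (frag_of s)))"
      using chain_boundary_chain_map[OF Pchain, of h] by (simp add: chain_map_add)
    also have "\<dots> = chain_map p h (chain_map p (Pair 1) (frag_of s) - chain_map p (Pair 0) (frag_of s))"
      by (simp only: bd)
    also have "\<dots> = chain_map p (h \<circ> Pair 1) (frag_of s) - chain_map p (h \<circ> Pair 0) (frag_of s)"
      by (simp only: chain_map_diff chain_map_chain_map)
    also have "h \<circ> Pair 1 = g"
      using h1 by (simp add: fun_eq_iff)
    also have "h \<circ> Pair 0 = f"
      using h0 by (simp add: fun_eq_iff)
    finally show "chain_boundary (Suc p) (chain_map (Suc p) h ?P)
        + chain_map p h (prism_extend (p - Suc 0) e' (chain_boundary p (frag_of s)))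
        = chain_map p g (frag_of s) - chain_map p f (frag_of s)" .
  qed
qed

text \<open>Each of the finitely many simplices of \<open>c\<close> becomes small after enough
  subdivisions and remains so afterwards; one common number \<open>m\<close> of subdivisions
  therefore works. Iterated subdivision is chain homotopic to the identity by an integral
  operator.\<close>

lemma small_field_relcycle_exists:
  assumes c: "c \<in> field_relcycle_set p X S"
    and open_cover: "\<And>U. U \<in> \<C> \<Longrightarrow> openin X U" "topspace X \<subseteq> \<Union>\<C>"
  obtains c' where "c' - c \<in> field_relboundary_set p X S" "c' \<in> field_chain_set p X"
    "\<And>f. f \<in> Poly_Mapping.keys c' \<Longrightarrow> \<exists>V\<in>\<C>. f \<in> standard_simplex p \<rightarrow> V"
proof -
  note cX = field_relcycle_setD[OF c]
  let ?Sd = "\<lambda>n. singular_subdivision p ^^ n"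
  have "\<forall>f\<in>Poly_Mapping.keys c. \<exists>n. \<forall>m g. n \<le> m \<longrightarrow>
      g \<in> Poly_Mapping.keys (?Sd m (frag_of f)) \<longrightarrow> (\<exists>V\<in>\<C>. g \<in> standard_simplex p \<rightarrow> V)"
  proof
    fix f assume f: "f \<in> Poly_Mapping.keys c"
    show "\<exists>n. \<forall>m g. n \<le> m \<longrightarrow> g \<in> Poly_Mapping.keys (?Sd m (frag_of f)) \<longrightarrow>
        (\<exists>V\<in>\<C>. g \<in> standard_simplex p \<rightarrow> V)"
    proof (rule sufficient_iterated_singular_subdivision_exists[of \<C> X p "frag_of f"])
      show "singular_chain p X (frag_of f)"
        using f cX(1) by (auto simp: field_chain_set_def singular_chain_of)
    qed (use open_cover in auto)
  qed
  from bchoice[OF this] obtain n where n: "\<forall>f\<in>Poly_Mapping.keys c. \<forall>m g. n f \<le> m \<longrightarrow>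
      g \<in> Poly_Mapping.keys (?Sd m (frag_of f)) \<longrightarrow> (\<exists>V\<in>\<C>. g \<in> standard_simplex p \<rightarrow> V)"
    by (rule exE)
  \<comment> \<open>Inserting 0 keeps the maximum meaningful for the zero chain.\<close>
  define m where "m = Max (insert 0 (n ` Poly_Mapping.keys c))"
  have m: "n f \<le> m" if "f \<in> Poly_Mapping.keys c" for f
    using that by (simp add: m_def)
  obtain h where h: "\<And>p. h p 0 = (0 :: 'a chain)"
    "\<And>p c1 c2. h p (c1 - c2) = h p c1 - h p c2"
    "\<And>p X c. singular_chain p X c \<Longrightarrow> singular_chain (Suc p) X (h p c)"
    "\<And>p X c. singular_chain p X c \<Longrightarrow> chain_boundary (Suc p) (h p c)
        + h (p - Suc 0) (chain_boundary p c) = (singular_subdivision p ^^ m) c - c"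
    by (rule chain_homotopic_iterated_singular_subdivision[where n = m]) (rule that)
  have diff: "base_change (?Sd m) c - base_change (\<lambda>x. x) c \<in> field_relboundary_set p X S"
  proof (rule base_change_chain_homotopy[OF h(2) _ _ _ c])
    show "singular_chain (Suc p) X (h p (frag_of f))" if "singular_simplex p X f" for f
      using that h(3) by (simp add: singular_chain_of)
    show "singular_chain p (subtopology X S) (h (p - Suc 0) (frag_of f))"
      if "p \<noteq> 0" "singular_simplex (p - Suc 0) (subtopology X S) f" for f
      using that h(3)[of "p - Suc 0"] by (simp add: singular_chain_of)
    show "chain_boundary (Suc p) (h p (frag_of f)) + h (p - Suc 0) (chain_boundary p (frag_of f))
        = ?Sd m (frag_of f) - frag_of f" if "singular_simplex p X f" for f
      using that h(4) by (simp add: singular_chain_of)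
  qed
  have Sd_chain: "singular_chain p X (?Sd m (frag_of f))" if "singular_simplex p X f" for f
  proof (induction m)
    case 0
    then show ?case using that by (simp add: singular_chain_of)
  next
    case (Suc m)
    then show ?case by (simp add: singular_chain_singular_subdivision)
  qed
  show thesis
  proof (rule that)
    show "base_change (?Sd m) c - c \<in> field_relboundary_set p X S"
      using diff by (simp add: base_change_ident)
    show "base_change (?Sd m) c \<in> field_chain_set p X"
      using cX(1) Sd_chain by (rule base_change_in_field_chain_set)
    fix g assume "g \<in> Poly_Mapping.keys (base_change (?Sd m) c)"
    then have "g \<in> (\<Union>f\<in>Poly_Mapping.keys c. Poly_Mapping.keys (?Sd m (frag_of f)))"
      by (rule subsetD[OF keys_base_change])
    then obtain f where f: "f \<in> Poly_Mapping.keys c" "g \<in> Poly_Mapping.keys (?Sd m (frag_of f))"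
      by (rule UN_E)
    then show "\<exists>V\<in>\<C>. g \<in> standard_simplex p \<rightarrow> V"
      using n[rule_format, OF f(1) m[OF f(1)] f(2)] by simp
  qed
qed

text \<open>Each simplex is assigned with its whole coefficient to one side, those in
  \<open>S\<close> to the first summand and the others to the second.\<close>

lemma field_chain_split:
  fixes c :: "('k::field, 'a) field_chain"
  assumes "Poly_Mapping.keys c \<subseteq> S \<union> T"
  obtains d e where "c = d + e" "Poly_Mapping.keys d \<subseteq> Poly_Mapping.keys c \<inter> S"
    "Poly_Mapping.keys e \<subseteq> Poly_Mapping.keys c \<inter> T"
proof
  define d where "d = Poly_Mapping.mapp (\<lambda>f a. a when f \<in> S) c"
  have d: "Poly_Mapping.lookup d f = (Poly_Mapping.lookup c f when f \<in> S)" for f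
    by (auto simp: d_def lookup_mapp when_def in_keys_iff)
  show "c = d + (c - d)" by simp
  show "Poly_Mapping.keys d \<subseteq> Poly_Mapping.keys c \<inter> S"
    by (auto simp: in_keys_iff d when_def split: if_splits)
  have "f \<in> T" if "Poly_Mapping.lookup c f \<noteq> 0" "f \<notin> S" for f
    using assms that by (auto simp: subset_iff simp flip: in_keys_iff)
  then show "Poly_Mapping.keys (c - d) \<subseteq> Poly_Mapping.keys c \<inter> T"
    by (auto simp: in_keys_iff lookup_minus d when_def split: if_splits)
qed

section \<open>Trivializations of pairs\<close>

lemma field_relcycle_subtopology:
  "c \<in> field_relcycle_set p (subtopology X A) S \<Longrightarrow> c \<in> field_relcycle_set p X S"
  unfolding field_relcycle_set_def subtopology_subtopology
  by (auto dest: field_chain_set_subtopologyD intro: field_chain_set_mono[of "A \<inter> S" S])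

lemma field_relboundary_subtopology:
  "c \<in> field_relboundary_set p (subtopology X A) S \<Longrightarrow> c \<in> field_relboundary_set p X S"
  unfolding field_relboundary_set_def subtopology_subtopology
  by (auto dest: field_chain_set_subtopologyD intro: field_chain_set_mono[of "A \<inter> S" S])

lemma field_relcycle_restrict:
  "field_relcycle_set p (subtopology X A) (A \<inter> S) = field_relcycle_set p (subtopology X A) S"
  by (simp add: field_relcycle_set_def subtopology_subtopology flip: Int_assoc)

lemmas field_relcycle_add = chain.subspace_add[OF subspace_field_relcycle_set]
  and field_relboundary_add = chain.subspace_add[OF subspace_field_relboundary_set]
  and field_relboundary_diff = chain.subspace_diff[OF subspace_field_relboundary_set]
  and field_relboundary_neg = chain.subspace_neg[OF subspace_field_relboundary_set]

locale pair_trivialization =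
  fixes E :: "'a topology" and B :: "'c topology" and \<pi> :: "'a \<Rightarrow> 'c" and F :: "'b topology"
    and E' :: "'a set" and F' :: "'b set" and U :: "'c set" and \<phi> :: "'a \<Rightarrow> 'c \<times> 'b"
  assumes trivial: "trivialization E B \<pi> F U \<phi>"
    and pair: "homeomorphic_map (subtopology E (bundle_preimage E \<pi> U \<inter> E'))
      (prod_topology (subtopology B U) (subtopology F F')) \<phi>"
    and F'_subset: "F' \<subseteq> topspace F"
begin

abbreviation part :: "'c set \<Rightarrow> 'a topology" where
  "part W \<equiv> subtopology E (bundle_preimage E \<pi> W)"

lemma topspace_part: "topspace (part W) = bundle_preimage E \<pi> W"
  by (auto simp: bundle_preimage_def)

lemma U_subset: "U \<subseteq> topspace B"
  using trivial by (simp add: trivialization_def openin_subset)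

definition \<psi> :: "'c \<times> 'b \<Rightarrow> 'a" where
  "\<psi> = (SOME g. homeomorphic_maps (part U) (prod_topology (subtopology B U) F) \<phi> g)"

lemma homeomorphic: "homeomorphic_maps (part U) (prod_topology (subtopology B U) F) \<phi> \<psi>"
proof -
  have "\<exists>g. homeomorphic_maps (part U) (prod_topology (subtopology B U) F) \<phi> g"
    using trivial by (simp add: trivialization_def homeomorphic_map_maps)
  then show ?thesis
    unfolding \<psi>_def by (rule someI_ex)
qed

definition fib :: "'a \<Rightarrow> 'b" where
  "fib e = snd (\<phi> e)"

text \<open>For fixed \<open>x\<close> the inclusion of the typical fiber as the fiber over
  \<open>x\<close>; over a contractible base it serves as a homotopy inverse of
  \<open>fib\<close>.\<close>

definition sec :: "'c \<Rightarrow> 'b \<Rightarrow> 'a" where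
  "sec x y = \<psi> (x, y)"

lemma continuous_phi: "continuous_map (part U) (prod_topology (subtopology B U) F) \<phi>"
  and continuous_psi: "continuous_map (prod_topology (subtopology B U) F) (part U) \<psi>"
  using homeomorphic by (simp_all add: homeomorphic_maps_def)

lemma phi_eq: "e \<in> bundle_preimage E \<pi> U \<Longrightarrow> \<phi> e = (\<pi> e, fib e)"
  using trivial by (simp add: fib_def trivialization_def prod_eq_iff)

lemma sec_fib:
  assumes "e \<in> bundle_preimage E \<pi> U" shows "\<psi> (\<pi> e, fib e) = e"
proof -
  have "\<psi> (\<phi> e) = e"
    using homeomorphic assms unfolding homeomorphic_maps_def topspace_part by blast
  then show ?thesis
    by (simp add: phi_eq[OF assms])
qed

lemma psi_in:
  assumes "w \<in> U" "y \<in> topspace F"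
  shows "\<psi> (w, y) \<in> bundle_preimage E \<pi> U" "\<pi> (\<psi> (w, y)) = w" "fib (\<psi> (w, y)) = y"
proof -
  have wy: "(w, y) \<in> topspace (prod_topology (subtopology B U) F)"
    using assms U_subset by auto
  then have in_U: "\<psi> (w, y) \<in> topspace (part U)"
    using continuous_map_image_subset_topspace[OF continuous_psi] by blast
  then show "\<psi> (w, y) \<in> bundle_preimage E \<pi> U"
    by (simp add: topspace_part)
  moreover have "\<phi> (\<psi> (w, y)) = (w, y)"
    using homeomorphic wy by (simp add: homeomorphic_maps_def)
  ultimately show "\<pi> (\<psi> (w, y)) = w" "fib (\<psi> (w, y)) = y"
    using phi_eq by auto
qed

text \<open>The homeomorphism of the pair enters through its surjectivity: in the chart
  \<open>E'\<close> becomes a product, so membership in \<open>E'\<close> depends on the fiber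
  coordinate alone.\<close>

lemma image_pair: "\<phi> ` (bundle_preimage E \<pi> U \<inter> E') = U \<times> F'"
proof -
  have "bundle_preimage E \<pi> U \<inter> E' \<subseteq> topspace E"
    by (auto simp: bundle_preimage_def)
  then have "topspace (subtopology E (bundle_preimage E \<pi> U \<inter> E')) = bundle_preimage E \<pi> U \<inter> E'"
    by auto
  moreover have "topspace (prod_topology (subtopology B U) (subtopology F F')) = U \<times> F'"
    using U_subset F'_subset by auto
  ultimately show ?thesis
    using homeomorphic_imp_surjective_map[OF pair] by simp
qed

lemma fib_pair:
  assumes "e \<in> bundle_preimage E \<pi> U" "e \<in> E'" shows "fib e \<in> F'"
proof -
  have "\<phi> e \<in> U \<times> F'"
    unfolding image_pair[symmetric] using assms by (intro imageI IntI)
  then show ?thesis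
    by (simp add: phi_eq[OF assms(1)])
qed

lemma psi_pair:
  assumes "w \<in> U" "y \<in> F'" shows "\<psi> (w, y) \<in> E'"
proof -
  have "(w, y) \<in> \<phi> ` (bundle_preimage E \<pi> U \<inter> E')"
    using assms by (simp add: image_pair)
  then obtain e where e: "(w, y) = \<phi> e" "e \<in> bundle_preimage E \<pi> U" "e \<in> E'"
    by blast
  then have "\<psi> (w, y) = e"
    using sec_fib phi_eq by simp
  with e show ?thesis by simp
qed

lemma preimage_mono: "W \<subseteq> W' \<Longrightarrow> bundle_preimage E \<pi> W \<subseteq> bundle_preimage E \<pi> W'"
  by (auto simp: bundle_preimage_def)

lemma part_mono: "W \<subseteq> W' \<Longrightarrow> part W = subtopology (part W') (bundle_preimage E \<pi> W)"
  using preimage_mono[of W W'] by (simp add: subtopology_subtopology Int_absorb1)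

lemma continuous_fib:
  assumes "W \<subseteq> U" shows "continuous_map (part W) F fib"
proof -
  have "continuous_map (part U) F (snd \<circ> \<phi>)"
    by (rule continuous_map_compose[OF continuous_phi continuous_map_snd])
  then have "continuous_map (part U) F fib"
    by (rule continuous_map_eq) (simp add: fib_def)
  then show ?thesis
    unfolding part_mono[OF assms] by (rule continuous_map_from_subtopology)
qed

lemma continuous_proj:
  assumes "W \<subseteq> U" shows "continuous_map (part W) (subtopology B W) \<pi>"
proof -
  have "continuous_map (part U) (subtopology B U) (fst \<circ> \<phi>)"
    by (rule continuous_map_compose[OF continuous_phi continuous_map_fst])
  then have "continuous_map (part U) (subtopology B U) \<pi>"
    by (rule continuous_map_eq) (use phi_eq topspace_part in auto)
  then have "continuous_map (part W) (subtopology B U) \<pi>"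
    unfolding part_mono[OF assms] by (rule continuous_map_from_subtopology)
  then show ?thesis
    by (auto simp: continuous_map_in_subtopology bundle_preimage_def)
qed

lemma continuous_psi_part:
  assumes "W \<subseteq> U" shows "continuous_map (prod_topology (subtopology B W) F) (part W) \<psi>"
proof -
  have "prod_topology (subtopology B W) F
      = subtopology (prod_topology (subtopology B U) F) (W \<times> topspace F)"
    using assms
    by (simp add: prod_topology_subtopology subtopology_subtopology flip: Times_Int_distrib1)
       (simp add: Int_absorb1)
  then have "continuous_map (prod_topology (subtopology B W) F) (part U) \<psi>"
    using continuous_map_from_subtopology[OF continuous_psi] by simp
  moreover have "\<psi> \<in> topspace (prod_topology (subtopology B W) F) \<rightarrow> bundle_preimage E \<pi> W"
  proof
    fix z assume "z \<in> topspace (prod_topology (subtopology B W) F)"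
    then obtain w y where "z = (w, y)" "w \<in> W" "y \<in> topspace F"
      by auto
    then show "\<psi> z \<in> bundle_preimage E \<pi> W"
      using psi_in[of w y] assms by (auto simp: bundle_preimage_def)
  qed
  ultimately show ?thesis
    unfolding part_mono[OF assms] by (simp add: continuous_map_in_subtopology image_subset_iff_funcset)
qed

lemma continuous_sec:
  assumes "W \<subseteq> U" "x \<in> W" shows "continuous_map F (part W) (sec x)"
proof -
  have "continuous_map F (prod_topology (subtopology B W) F) (\<lambda>y. (x, y))"
    using assms U_subset by (auto simp: continuous_map_pairwise comp_def)
  from continuous_map_compose[OF this continuous_psi_part[OF assms(1)]] show ?thesis
    by (simp add: comp_def sec_def[abs_def])
qed

lemma fib_image: "W \<subseteq> U \<Longrightarrow> fib ` (topspace (part W) \<inter> E') \<subseteq> F'"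
  using fib_pair preimage_mono[of W U] unfolding topspace_part by blast

lemma sec_image: "x \<in> U \<Longrightarrow> sec x ` (topspace F \<inter> F') \<subseteq> E'"
  using psi_pair unfolding sec_def by blast

lemma fib_relcycle:
  "W \<subseteq> U \<Longrightarrow> c \<in> field_relcycle_set p (part W) E' \<Longrightarrow> field_chain_map p fib c \<in> field_relcycle_set p F F'"
  by (rule field_relcycle_map[OF _ continuous_fib fib_image])

lemma fib_relboundary:
  "W \<subseteq> U \<Longrightarrow> c \<in> field_relboundary_set p (part W) E' \<Longrightarrow> field_chain_map p fib c \<in> field_relboundary_set p F F'"
  by (rule field_relboundary_map[OF _ continuous_fib fib_image])

lemma sec_relcycle:
  assumes "W \<subseteq> U" "x \<in> W" "c \<in> field_relcycle_set p F F'"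
  shows "field_chain_map p (sec x) c \<in> field_relcycle_set p (part W) E'"
  using assms by (intro field_relcycle_map[OF assms(3) continuous_sec sec_image]) auto

lemma sec_relboundary:
  assumes "W \<subseteq> U" "x \<in> W" "c \<in> field_relboundary_set p F F'"
  shows "field_chain_map p (sec x) c \<in> field_relboundary_set p (part W) E'"
  using assms by (intro field_relboundary_map[OF assms(3) continuous_sec sec_image]) auto

text \<open>A contraction of the base to \<open>x\<close> lifts through the chart with the fiber
  coordinate held fixed. This deforms the identity into \<open>sec x \<circ> fib\<close> and
  preserves \<open>E'\<close>.\<close>

lemma sec_fib_homologous:
  assumes W: "W \<subseteq> U" "contractible_space (subtopology B W)" "x \<in> W"
    and c: "c \<in> field_relcycle_set p (part W) E'"
  shows "field_chain_map p (sec x) (field_chain_map p fib c) - c \<in> field_relboundary_set p (part W) E'"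
proof -
  have "x \<in> topspace (subtopology B W)"
    using W U_subset by auto
  then have "homotopic_with (\<lambda>x. True) (subtopology B W) (subtopology B W) id (\<lambda>_. x)"
    using W(2) by (simp add: contractible_space_alt)
  then obtain k where k: "continuous_map (cylinder (subtopology B W)) (subtopology B W) k"
    "\<And>w. k (0, w) = w" "\<And>w. k (1, w) = x"
    unfolding homotopic_with_def by auto
  have kW: "k (t, w) \<in> W" if "t \<in> {0..1}" "w \<in> W" for t w
  proof -
    have "(t, w) \<in> topspace (cylinder (subtopology B W))"
      using that W U_subset by auto
    then have "k (t, w) \<in> topspace (subtopology B W)"
      using continuous_map_image_subset_topspace[OF k(1)] by blast
    then show ?thesis by simp
  qed
  \<comment> \<open>The base point moves along the contraction \<open>k\<close>, the fiber
    coordinate stays.\<close>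
  define h where "h = (\<lambda>(t, e). \<psi> (k (t, \<pi> e), fib e))"
  have "continuous_map (cylinder (part W)) (subtopology B W) (k \<circ> (\<lambda>(t, e). (t, \<pi> e)))"
    by (rule continuous_map_compose[OF _ k(1)])
       (simp add: continuous_map_prod_top continuous_proj[OF W(1)])
  moreover have "continuous_map (cylinder (part W)) F (fib \<circ> snd)"
    by (rule continuous_map_compose[OF continuous_map_snd continuous_fib[OF W(1)]])
  ultimately have "continuous_map (cylinder (part W)) (prod_topology (subtopology B W) F)
      (\<lambda>z. ((k \<circ> (\<lambda>(t, e). (t, \<pi> e))) z, (fib \<circ> snd) z))"
    by (rule continuous_map_pairedI)
  from continuous_map_compose[OF this continuous_psi_part[OF W(1)]]
  have cont_h: "continuous_map (cylinder (part W)) (part W) h"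
    by (simp add: h_def comp_def case_prod_unfold)
  have h_pair: "h (t, e) \<in> E'" if t: "t \<in> {0..1}" and e: "e \<in> bundle_preimage E \<pi> W \<inter> E'" for t e
  proof -
    have "k (t, \<pi> e) \<in> U"
      using kW[OF t] e W(1) by (auto simp: bundle_preimage_def)
    moreover have "fib e \<in> F'"
      using fib_pair e preimage_mono[OF W(1)] by blast
    ultimately show ?thesis
      by (simp add: h_def psi_pair)
  qed
  \<comment> \<open>The condition on a homotopy of pairs ranges over all points of the subset, also
    outside the space. Hence \<open>E'\<close> is first cut down to the part over \<open>W\<close>,
    which does not change the relative cycles.\<close>
  have "homotopic_with (\<lambda>h. h \<in> (bundle_preimage E \<pi> W \<inter> E') \<rightarrow> E') (part W) (part W)
      (\<lambda>e. h (0, e)) (\<lambda>e. h (1, e))"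
    unfolding homotopic_with_def
    using cont_h h_pair by (intro exI[of _ h] conjI allI ballI refl Pi_I)
  moreover have "c \<in> field_relcycle_set p (part W) (bundle_preimage E \<pi> W \<inter> E')"
    using c by (simp add: field_relcycle_restrict)
  ultimately have "field_chain_map p (\<lambda>e. h (1, e)) c - field_chain_map p (\<lambda>e. h (0, e)) c
      \<in> field_relboundary_set p (part W) E'"
    by (rule homotopic_imp_field_relboundary)
  moreover have "field_chain_map p (\<lambda>e. h (0, e)) c = c"
  proof (rule field_chain_map_ident)
    show "c \<in> field_chain_set p (part W)"
      using field_relcycle_setD(1)[OF c] .
    show "h (0, e) = e" if "e \<in> topspace (part W)" for e
      using that sec_fib preimage_mono[OF W(1)] unfolding topspace_part by (auto simp: h_def k(2))
  qed
  moreover have "(\<lambda>e. h (1, e)) = sec x \<circ> fib"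
    by (auto simp: h_def k(3) sec_def)
  ultimately show ?thesis
    by (simp add: field_chain_map_compose)
qed

end

section \<open>Bundles covered by two charts\<close>

lemma field_chain_set_Int:
  "c \<in> field_chain_set p (subtopology X S) \<Longrightarrow> c \<in> field_chain_set p (subtopology X T) \<Longrightarrow>
    c \<in> field_chain_set p (subtopology X (S \<inter> T))"
  by (auto simp: field_chain_set_def subset_iff singular_simplex_subtopology)

text \<open>Collects all that is used of the circle: two contractible charts whose overlap consists
  of two disjoint, open, contractible pieces.\<close>

locale two_chart_pair =
  U: pair_trivialization E B \<pi> F E' F' U \<phi> + V: pair_trivialization E B \<pi> F E' F' V \<psi>
  for E :: "'a topology" and B :: "'c topology" and \<pi> :: "'a \<Rightarrow> 'c" and F :: "'b topology"
    and E' F' U \<phi> V \<psi> +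
  fixes W\<^sub>1 W\<^sub>2 :: "'c set" and x y :: 'c
  assumes cont_proj: "continuous_map E B \<pi>"
    and cover: "topspace B \<subseteq> U \<union> V"
    and overlap: "U \<inter> V = W\<^sub>1 \<union> W\<^sub>2" "W\<^sub>1 \<inter> W\<^sub>2 = {}"
    and open_overlap: "openin B W\<^sub>1" "openin B W\<^sub>2"
    and base_points: "x \<in> W\<^sub>1" "y \<in> W\<^sub>2"
    and contractible: "contractible_space (subtopology B U)" "contractible_space (subtopology B V)"
      "contractible_space (subtopology B W\<^sub>1)" "contractible_space (subtopology B W\<^sub>2)"
begin

abbreviation over :: "'c set \<Rightarrow> 'a set" where
  "over W \<equiv> bundle_preimage E \<pi> W"

abbreviation part :: "'c set \<Rightarrow> 'a topology" where
  "part W \<equiv> subtopology E (over W)"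

lemma overlap_subset: "W\<^sub>1 \<subseteq> U" "W\<^sub>1 \<subseteq> V" "W\<^sub>2 \<subseteq> U" "W\<^sub>2 \<subseteq> V" "x \<in> U" "x \<in> V"
  using overlap base_points by auto

lemma openin_over: "openin B W \<Longrightarrow> openin E (over W)"
  using openin_continuous_map_preimage[OF cont_proj] by (simp add: bundle_preimage_def)

lemma relcycle_part_mono:
  "W \<subseteq> W' \<Longrightarrow> c \<in> field_relcycle_set p (part W) E' \<Longrightarrow> c \<in> field_relcycle_set p (part W') E'"
  using U.part_mono[of W W'] field_relcycle_subtopology by metis

lemma chain_part_mono:
  "W \<subseteq> W' \<Longrightarrow> c \<in> field_chain_set p (part W) \<Longrightarrow> c \<in> field_chain_set p (part W')"
  using U.preimage_mono field_chain_set_mono by metis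

lemma chain_part_pair_mono:
  assumes "W \<subseteq> W'" "c \<in> field_chain_set p (subtopology (part W) E')"
  shows "c \<in> field_chain_set p (subtopology (part W') E')"
  using assms(2) field_chain_set_mono[of "over W \<inter> E'" "over W' \<inter> E'"] U.preimage_mono[OF assms(1)]
  unfolding subtopology_subtopology by blast

text \<open>Over a contractible chart every relative cycle can be pushed into the fiber over \<open>x\<close>; a cycle over
  \<open>V\<close> pushed there becomes a cycle over \<open>U\<close>.\<close>

lemma chart_cycles_from_fiber:
  assumes zU: "zU \<in> field_relcycle_set p (part U) E'" and zV: "zV \<in> field_relcycle_set p (part V) E'"
  shows "\<exists>n\<in>field_relboundary_set p E E'. \<exists>w\<in>field_relcycle_set p F F'.
    zU + zV = n + field_chain_map p (U.sec x) w"
proof -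
  define v where "v = field_chain_map p (V.sec x) (field_chain_map p V.fib zV)"
  define u where "u = zU + v"
  define w where "w = field_chain_map p U.fib u"
  have "v \<in> field_relcycle_set p (part W\<^sub>1) E'"
    unfolding v_def
    by (intro V.sec_relcycle V.fib_relcycle[OF subset_refl] zV overlap_subset base_points)
  then have u: "u \<in> field_relcycle_set p (part U) E'"
    unfolding u_def using zU relcycle_part_mono[OF overlap_subset(1)] by (intro field_relcycle_add)
  have "v - zV \<in> field_relboundary_set p (part V) E'"
    unfolding v_def by (rule V.sec_fib_homologous[OF subset_refl contractible(2) overlap_subset(6) zV])
  then have a: "v - zV \<in> field_relboundary_set p E E'"
    by (rule field_relboundary_subtopology)
  have "field_chain_map p (U.sec x) w - u \<in> field_relboundary_set p (part U) E'"
    unfolding w_def by (rule U.sec_fib_homologous[OF subset_refl contractible(1) overlap_subset(5) u])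
  then have b: "field_chain_map p (U.sec x) w - u \<in> field_relboundary_set p E E'"
    by (rule field_relboundary_subtopology)
  have "zU + zV = - ((v - zV) + (field_chain_map p (U.sec x) w - u)) + field_chain_map p (U.sec x) w"
    by (simp add: u_def)
  moreover have "- ((v - zV) + (field_chain_map p (U.sec x) w - u)) \<in> field_relboundary_set p E E'"
    using a b by (intro field_relboundary_neg field_relboundary_add)
  moreover have "w \<in> field_relcycle_set p F F'"
    unfolding w_def by (rule U.fib_relcycle[OF subset_refl u])
  ultimately show ?thesis by blast
qed

text \<open>Subdivision makes the cycle small for the two charts. The summands are mere chains: in
  positive degree their boundaries may leave \<open>E'\<close> over the overlap.\<close>

lemma relcycle_splits:
  assumes "z \<in> field_relcycle_set p E E'"
  obtains zU zV where "zU \<in> field_chain_set p (part U)" "zV \<in> field_chain_set p (part V)"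
    "z - zU - zV \<in> field_relboundary_set p E E'"
proof -
  have "openin E (over U)" "openin E (over V)"
    using U.trivial V.trivial openin_over by (simp_all add: trivialization_def)
  then have op: "openin E G" if "G \<in> {over U, over V}" for G
    using that by blast
  have "topspace E \<subseteq> \<Union> {over U, over V}"
    using cover continuous_map_image_subset_topspace[OF cont_proj] by (auto simp: bundle_preimage_def)
  from small_field_relcycle_exists[OF assms op this]
  obtain c where c: "c - z \<in> field_relboundary_set p E E'" "c \<in> field_chain_set p E"
    "\<And>f. f \<in> Poly_Mapping.keys c \<Longrightarrow> \<exists>G\<in>{over U, over V}. f \<in> standard_simplex p \<rightarrow> G"
    by metis
  have "Poly_Mapping.keys c \<subseteq> singular_simplex_set p (part U) \<union> singular_simplex_set p (part V)"
    using c(2,3) by (fastforce simp: field_chain_set_def singular_simplex_subtopology)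
  then obtain zU zV where z: "c = zU + zV" "Poly_Mapping.keys zU \<subseteq> Poly_Mapping.keys c \<inter> singular_simplex_set p (part U)"
    "Poly_Mapping.keys zV \<subseteq> Poly_Mapping.keys c \<inter> singular_simplex_set p (part V)"
    by (rule field_chain_split)
  have eq: "- (c - z) = z - zU - zV"
    by (simp add: z(1))
  have "z - zU - zV \<in> field_relboundary_set p E E'"
    using field_relboundary_neg[OF c(1)] unfolding eq .
  then show thesis
    using z by (intro that[of zU zV]) (auto simp: field_chain_set_def)
qed

text \<open>
  The Mayer--Vietoris connecting homomorphism followed by the projection to the part over \<open>W\<^sub>1\<close>,
  kept as a linear relation between chains to avoid choices.
\<close>

definition splitting :: "nat \<Rightarrow> ('k::field, 'a) field_chain \<Rightarrow> ('k, 'b) field_chain \<Rightarrow> bool" where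
  "splitting p z w \<longleftrightarrow> (\<exists>zU zV c\<^sub>1 c\<^sub>2.
     zU \<in> field_chain_set (Suc p) (part U) \<and> zV \<in> field_chain_set (Suc p) (part V) \<and>
     c\<^sub>1 \<in> field_relcycle_set p (part W\<^sub>1) E' \<and> c\<^sub>2 \<in> field_relcycle_set p (part W\<^sub>2) E' \<and>
     z - zU - zV \<in> field_relboundary_set (Suc p) E E' \<and>
     field_chain_boundary (Suc p) zU - (c\<^sub>1 + c\<^sub>2) \<in> field_chain_set p (subtopology (part U) E') \<and>
     field_chain_boundary (Suc p) zV + (c\<^sub>1 + c\<^sub>2) \<in> field_chain_set p (subtopology (part V) E') \<and>
     w = field_chain_map p U.fib c\<^sub>1)"

lemma splitting_add:
  assumes "splitting p z w" "splitting p z' w'"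
  shows "splitting p (z + z') (w + w')"
proof -
  obtain zU zV c\<^sub>1 c\<^sub>2 where a: "zU \<in> field_chain_set (Suc p) (part U)" "zV \<in> field_chain_set (Suc p) (part V)"
     "c\<^sub>1 \<in> field_relcycle_set p (part W\<^sub>1) E'" "c\<^sub>2 \<in> field_relcycle_set p (part W\<^sub>2) E'"
     "z - zU - zV \<in> field_relboundary_set (Suc p) E E'"
     "field_chain_boundary (Suc p) zU - (c\<^sub>1 + c\<^sub>2) \<in> field_chain_set p (subtopology (part U) E')"
     "field_chain_boundary (Suc p) zV + (c\<^sub>1 + c\<^sub>2) \<in> field_chain_set p (subtopology (part V) E')"
     "w = field_chain_map p U.fib c\<^sub>1"
    using assms(1) unfolding splitting_def by blast
  obtain zU' zV' c\<^sub>1' c\<^sub>2' where b: "zU' \<in> field_chain_set (Suc p) (part U)" "zV' \<in> field_chain_set (Suc p) (part V)"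
     "c\<^sub>1' \<in> field_relcycle_set p (part W\<^sub>1) E'" "c\<^sub>2' \<in> field_relcycle_set p (part W\<^sub>2) E'"
     "z' - zU' - zV' \<in> field_relboundary_set (Suc p) E E'"
     "field_chain_boundary (Suc p) zU' - (c\<^sub>1' + c\<^sub>2') \<in> field_chain_set p (subtopology (part U) E')"
     "field_chain_boundary (Suc p) zV' + (c\<^sub>1' + c\<^sub>2') \<in> field_chain_set p (subtopology (part V) E')"
     "w' = field_chain_map p U.fib c\<^sub>1'"
    using assms(2) unfolding splitting_def by blast
  \<comment> \<open>Regroups each clause as a sum of two members of the same subspace.\<close>
  have eqs: "(z + z') - (zU + zU') - (zV + zV') = (z - zU - zV) + (z' - zU' - zV')"
    "field_chain_boundary (Suc p) (zU + zU') - ((c\<^sub>1 + c\<^sub>1') + (c\<^sub>2 + c\<^sub>2'))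
      = (field_chain_boundary (Suc p) zU - (c\<^sub>1 + c\<^sub>2)) + (field_chain_boundary (Suc p) zU' - (c\<^sub>1' + c\<^sub>2'))"
    "field_chain_boundary (Suc p) (zV + zV') + ((c\<^sub>1 + c\<^sub>1') + (c\<^sub>2 + c\<^sub>2'))
      = (field_chain_boundary (Suc p) zV + (c\<^sub>1 + c\<^sub>2)) + (field_chain_boundary (Suc p) zV' + (c\<^sub>1' + c\<^sub>2'))"
    by (simp_all add: algebra_simps)
  show ?thesis
    unfolding splitting_def
    by (rule exI[of _ "zU + zU'"], rule exI[of _ "zV + zV'"], rule exI[of _ "c\<^sub>1 + c\<^sub>1'"], rule exI[of _ "c\<^sub>2 + c\<^sub>2'"],
        unfold eqs, intro conjI field_chain_set_add field_relcycle_add field_relboundary_add a(1-7) b(1-7))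
       (simp add: a(8) b(8))
qed

lemma splitting_scale:
  assumes "splitting p z w"
  shows "splitting p (field_chain_scale a z) (field_chain_scale a w)"
proof -
  obtain zU zV c\<^sub>1 c\<^sub>2 where *: "zU \<in> field_chain_set (Suc p) (part U)" "zV \<in> field_chain_set (Suc p) (part V)"
     "c\<^sub>1 \<in> field_relcycle_set p (part W\<^sub>1) E'" "c\<^sub>2 \<in> field_relcycle_set p (part W\<^sub>2) E'"
     "z - zU - zV \<in> field_relboundary_set (Suc p) E E'"
     "field_chain_boundary (Suc p) zU - (c\<^sub>1 + c\<^sub>2) \<in> field_chain_set p (subtopology (part U) E')"
     "field_chain_boundary (Suc p) zV + (c\<^sub>1 + c\<^sub>2) \<in> field_chain_set p (subtopology (part V) E')"
     "w = field_chain_map p U.fib c\<^sub>1"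
    using assms unfolding splitting_def by blast
  let ?s = "field_chain_scale a"
  have eqs: "?s z - ?s zU - ?s zV = ?s (z - zU - zV)"
    "field_chain_boundary (Suc p) (?s zU) - (?s c\<^sub>1 + ?s c\<^sub>2) = ?s (field_chain_boundary (Suc p) zU - (c\<^sub>1 + c\<^sub>2))"
    "field_chain_boundary (Suc p) (?s zV) + (?s c\<^sub>1 + ?s c\<^sub>2) = ?s (field_chain_boundary (Suc p) zV + (c\<^sub>1 + c\<^sub>2))"
    by (simp_all add: chain.scale_right_distrib chain.scale_right_diff_distrib)
  show ?thesis
    unfolding splitting_def
    by (rule exI[of _ "?s zU"], rule exI[of _ "?s zV"], rule exI[of _ "?s c\<^sub>1"], rule exI[of _ "?s c\<^sub>2"],
        unfold eqs, intro conjI field_chain_set_scale chain.subspace_scale[OF subspace_field_relcycle_set]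
          chain.subspace_scale[OF subspace_field_relboundary_set] *(1-7))
       (simp add: *(8))
qed

text \<open>The image of a simplex is connected, and the parts over the two arcs are disjoint and
  open.\<close>

lemma simplex_over_overlap:
  assumes "singular_simplex p (subtopology E (over U \<inter> over V)) f"
  shows "singular_simplex p (part W\<^sub>1) f \<or> singular_simplex p (part W\<^sub>2) f"
proof -
  let ?I = "f ` standard_simplex p"
  have f: "singular_simplex p E f" "?I \<subseteq> over U \<inter> over V"
    using assms by (simp_all add: singular_simplex_subtopology)
  have "connectedin E ?I"
    using f(1) connectedin_continuous_map_image[of "simplex_space p" E f "standard_simplex p"]
      connectedin_standard_simplex[of p] by (simp add: singular_simplex_def connectedin_subtopology)
  moreover have "?I \<subseteq> over W\<^sub>1 \<union> over W\<^sub>2"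
    using f(2) overlap(1) unfolding bundle_preimage_def by blast
  moreover have "over W\<^sub>1 \<inter> over W\<^sub>2 = {}"
    using overlap by (auto simp: bundle_preimage_def)
  ultimately have "?I \<subseteq> over W\<^sub>1 \<or> ?I \<subseteq> over W\<^sub>2"
    using openin_over[OF open_overlap(1)] openin_over[OF open_overlap(2)]
    unfolding connectedin by blast
  then show ?thesis
    using f(1) by (auto simp: singular_simplex_subtopology)
qed

text \<open>Excludes cancellation between chains over the two arcs.\<close>

lemma keys_disjoint_over_overlap:
  assumes "c \<in> field_chain_set p (part W\<^sub>1)" "d \<in> field_chain_set p (part W\<^sub>2)"
  shows "Poly_Mapping.keys c \<inter> Poly_Mapping.keys d = {}"
proof (rule ccontr)
  assume "Poly_Mapping.keys c \<inter> Poly_Mapping.keys d \<noteq> {}"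
  then obtain f where "f \<in> Poly_Mapping.keys c" "f \<in> Poly_Mapping.keys d"
    by blast
  then have "f ` standard_simplex p \<subseteq> over W\<^sub>1 \<inter> over W\<^sub>2"
    using assms by (auto simp: field_chain_set_def subset_iff singular_simplex_subtopology)
  moreover have "over W\<^sub>1 \<inter> over W\<^sub>2 = {}"
    using overlap by (auto simp: bundle_preimage_def)
  ultimately show False
    using nonempty_standard_simplex[of p] by auto
qed

text \<open>The boundaries of the two pieces share no simplex, so nothing cancels in their sum; if
  the sum lies in \<open>E'\<close>, so does each boundary.\<close>

lemma relcycle_overlap_splits:
  assumes c: "c \<in> field_chain_set p (part U)" "c \<in> field_chain_set p (part V)"
    and bc: "field_chain_boundary p c \<in> field_chain_set (p - Suc 0) (subtopology E E')"
  obtains c\<^sub>1 c\<^sub>2 where "c = c\<^sub>1 + c\<^sub>2" "c\<^sub>1 \<in> field_relcycle_set p (part W\<^sub>1) E'"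
    "c\<^sub>2 \<in> field_relcycle_set p (part W\<^sub>2) E'"
proof -
  have "c \<in> field_chain_set p (subtopology E (over U \<inter> over V))"
    using c by (rule field_chain_set_Int)
  then have "Poly_Mapping.keys c \<subseteq> singular_simplex_set p (part W\<^sub>1) \<union> singular_simplex_set p (part W\<^sub>2)"
    using simplex_over_overlap by (auto simp: field_chain_set_def)
  then obtain c\<^sub>1 c\<^sub>2 where cc: "c = c\<^sub>1 + c\<^sub>2"
    "Poly_Mapping.keys c\<^sub>1 \<subseteq> Poly_Mapping.keys c \<inter> singular_simplex_set p (part W\<^sub>1)"
    "Poly_Mapping.keys c\<^sub>2 \<subseteq> Poly_Mapping.keys c \<inter> singular_simplex_set p (part W\<^sub>2)"
    by (rule field_chain_split)
  have c12: "c\<^sub>1 \<in> field_chain_set p (part W\<^sub>1)" "c\<^sub>2 \<in> field_chain_set p (part W\<^sub>2)"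
    using cc by (auto simp: field_chain_set_def)
  let ?b1 = "field_chain_boundary p c\<^sub>1" and ?b2 = "field_chain_boundary p c\<^sub>2"
  have b12: "?b1 \<in> field_chain_set (p - Suc 0) (part W\<^sub>1)" "?b2 \<in> field_chain_set (p - Suc 0) (part W\<^sub>2)"
    using c12 field_chain_boundary_in by blast+
  have disj: "Poly_Mapping.keys ?b1 \<inter> Poly_Mapping.keys ?b2 = {}"
    using b12 by (rule keys_disjoint_over_overlap)
  have keys: "Poly_Mapping.keys a \<subseteq> Poly_Mapping.keys (a + b)"
    if "Poly_Mapping.keys a \<inter> Poly_Mapping.keys b = {}" for a b :: "('d, 'a) field_chain"
    using that by (auto simp: in_keys_iff lookup_add disjoint_iff)
  have "?b1 + ?b2 \<in> field_chain_set (p - Suc 0) (subtopology E E')"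
    using bc by (simp add: cc(1))
  then have "?b1 \<in> field_chain_set (p - Suc 0) (subtopology E E')"
    "?b2 \<in> field_chain_set (p - Suc 0) (subtopology E E')"
    using keys[OF disj] keys[of ?b2 ?b1] disj unfolding field_chain_set_def
    by (auto simp: add.commute Int_commute)
  then have "?b1 \<in> field_chain_set (p - Suc 0) (subtopology (part W\<^sub>1) E')"
    "?b2 \<in> field_chain_set (p - Suc 0) (subtopology (part W\<^sub>2) E')"
    unfolding subtopology_subtopology using b12 by (auto intro: field_chain_set_Int)
  then show thesis
    using that[of c\<^sub>1 c\<^sub>2] cc(1) c12 by (simp add: field_relcycle_set_def)
qed

text \<open>The construction of the connecting map. The boundaries of \<open>zU\<close> and
  \<open>zV\<close> add up to a chain in \<open>E'\<close>, which is distributed over the charts as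
  \<open>eU + eV\<close>. Then \<open>?bU - eU\<close> equals \<open>eV - ?bV\<close>, so it lies
  over both charts and can be cut along the two arcs.\<close>

lemma splitting_exists:
  assumes z: "z \<in> field_relcycle_set (Suc p) E E'"
  shows "\<exists>w\<in>field_relcycle_set p F F'. splitting p z w"
proof -
  obtain zU zV where zUV: "zU \<in> field_chain_set (Suc p) (part U)" "zV \<in> field_chain_set (Suc p) (part V)"
    "z - zU - zV \<in> field_relboundary_set (Suc p) E E'"
    using relcycle_splits[OF z] .
  let ?bU = "field_chain_boundary (Suc p) zU" and ?bV = "field_chain_boundary (Suc p) zV"
  \<comment> \<open>Relative boundaries are relative cycles, so \<open>zU + zV\<close> is a relative
    cycle although its summands need not be.\<close>
  have "z - zU - zV \<in> field_relcycle_set (Suc p) E E'"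
    using zUV(3) field_relboundary_subset_relcycle by blast
  then have "z - (z - zU - zV) \<in> field_relcycle_set (Suc p) E E'"
    using z chain.subspace_diff[OF subspace_field_relcycle_set] by blast
  then have bUV: "?bU + ?bV \<in> field_chain_set p (subtopology E E')"
    by (simp add: field_relcycle_set_def add.commute)
  have b: "?bU \<in> field_chain_set p (part U)" "?bV \<in> field_chain_set p (part V)"
    using field_chain_boundary_in[OF zUV(1)] field_chain_boundary_in[OF zUV(2)] by simp_all
  have "Poly_Mapping.keys (?bU + ?bV) \<subseteq>
      singular_simplex_set p (subtopology (part U) E') \<union> singular_simplex_set p (subtopology (part V) E')"
    using bUV b Poly_Mapping.keys_add[of ?bU ?bV]
    unfolding field_chain_set_def subtopology_subtopology singular_simplex_subtopology by blast
  then obtain eU eV where e: "?bU + ?bV = eU + eV"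
    "Poly_Mapping.keys eU \<subseteq> Poly_Mapping.keys (?bU + ?bV) \<inter> singular_simplex_set p (subtopology (part U) E')"
    "Poly_Mapping.keys eV \<subseteq> Poly_Mapping.keys (?bU + ?bV) \<inter> singular_simplex_set p (subtopology (part V) E')"
    by (rule field_chain_split)
  have eUV: "eU \<in> field_chain_set p (subtopology (part U) E')" "eV \<in> field_chain_set p (subtopology (part V) E')"
    using e by (auto simp: field_chain_set_def)
  let ?c = "?bU - eU"
  have c_eq: "?c = eV - ?bV"
    using e(1) by (simp add: algebra_simps)
  have cU: "?c \<in> field_chain_set p (part U)"
    using b(1) field_chain_set_subtopologyD[OF eUV(1)] by (rule field_chain_set_diff)
  have cV: "?c \<in> field_chain_set p (part V)"
    unfolding c_eq using field_chain_set_subtopologyD[OF eUV(2)] b(2) by (rule field_chain_set_diff)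
  have "eU \<in> field_chain_set p (subtopology E E')"
    using eUV(1) field_chain_set_mono[of "over U \<inter> E'" E'] unfolding subtopology_subtopology by blast
  then have "- field_chain_boundary p eU \<in> field_chain_set (p - Suc 0) (subtopology E E')"
    by (intro field_chain_set_neg field_chain_boundary_in)
  then have "field_chain_boundary p ?c \<in> field_chain_set (p - Suc 0) (subtopology E E')"
    using field_chain_boundary_boundary[OF zUV(1)] by simp
  from relcycle_overlap_splits[OF cU cV this]
  obtain c\<^sub>1 c\<^sub>2 where c: "?c = c\<^sub>1 + c\<^sub>2" "c\<^sub>1 \<in> field_relcycle_set p (part W\<^sub>1) E'"
    "c\<^sub>2 \<in> field_relcycle_set p (part W\<^sub>2) E'"
    by blast
  have "?bU - (c\<^sub>1 + c\<^sub>2) = eU"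
    unfolding c(1)[symmetric] by simp
  moreover have "?bV + (c\<^sub>1 + c\<^sub>2) = eV"
    unfolding c(1)[symmetric] c_eq by simp
  ultimately have "splitting p z (field_chain_map p U.fib c\<^sub>1)"
    unfolding splitting_def using zUV c(2,3) eUV by metis
  then show ?thesis
    using U.fib_relcycle[OF overlap_subset(1) c(2)] by blast
qed

text \<open>Once \<open>c\<^sub>1\<close> and \<open>c\<^sub>2\<close> both bound over their arcs,
  the bounding chains correct \<open>zU\<close> and \<open>zV\<close> to relative cycles over the
  charts, which come from the fiber over \<open>x\<close>.\<close>

lemma splitting_kernel:
  assumes z: "splitting p z w" and w: "w \<in> field_relboundary_set p F F'"
  shows "\<exists>n\<in>field_relboundary_set (Suc p) E E'. \<exists>y\<in>field_relcycle_set (Suc p) F F'.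
    z = n + field_chain_map (Suc p) (U.sec x) y"
proof -
  obtain zU zV c\<^sub>1 c\<^sub>2 where *: "zU \<in> field_chain_set (Suc p) (part U)" "zV \<in> field_chain_set (Suc p) (part V)"
     "c\<^sub>1 \<in> field_relcycle_set p (part W\<^sub>1) E'" "c\<^sub>2 \<in> field_relcycle_set p (part W\<^sub>2) E'"
     "z - zU - zV \<in> field_relboundary_set (Suc p) E E'"
     "field_chain_boundary (Suc p) zU - (c\<^sub>1 + c\<^sub>2) \<in> field_chain_set p (subtopology (part U) E')"
     "field_chain_boundary (Suc p) zV + (c\<^sub>1 + c\<^sub>2) \<in> field_chain_set p (subtopology (part V) E')"
     "w = field_chain_map p U.fib c\<^sub>1"
    using z unfolding splitting_def by blast
  \<comment> \<open>Over a contractible base the fiber coordinate detects whether a cycle bounds: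
    push the fiber cycle back with \<open>sec\<close> and compare.\<close>
  have boundary_if_fib: "c \<in> field_relboundary_set p (part W) E'"
    if W: "W \<subseteq> U" "contractible_space (subtopology B W)" "v \<in> W"
      and c: "c \<in> field_relcycle_set p (part W) E'"
      and "field_chain_map p U.fib c \<in> field_relboundary_set p F F'" for W v c
  proof -
    let ?s = "field_chain_map p (U.sec v) (field_chain_map p U.fib c)"
    have "?s - (?s - c) \<in> field_relboundary_set p (part W) E'"
      by (intro field_relboundary_diff U.sec_relboundary U.sec_fib_homologous that)
    then show ?thesis by simp
  qed
  have "c\<^sub>1 \<in> field_relboundary_set p (part W\<^sub>1) E'"
    using w *(3,8) by (intro boundary_if_fib[OF overlap_subset(1) contractible(3) base_points(1)]) simp_all
  then obtain d\<^sub>1 e\<^sub>1 where d1: "d\<^sub>1 \<in> field_chain_set (Suc p) (part W\<^sub>1)"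
    "e\<^sub>1 \<in> field_chain_set p (subtopology (part W\<^sub>1) E')" "c\<^sub>1 = field_chain_boundary (Suc p) d\<^sub>1 + e\<^sub>1"
    unfolding field_relboundary_iff by blast
  let ?g = "field_chain_boundary (Suc p) zU - (c\<^sub>1 + c\<^sub>2)"
  have d1U: "d\<^sub>1 \<in> field_chain_set (Suc p) (part U)" and d1V: "d\<^sub>1 \<in> field_chain_set (Suc p) (part V)"
    using d1(1) overlap_subset chain_part_mono by metis+
  have e1U: "e\<^sub>1 \<in> field_chain_set p (subtopology (part U) E')"
    and e1V: "e\<^sub>1 \<in> field_chain_set p (subtopology (part V) E')"
    using d1(2) overlap_subset chain_part_pair_mono by metis+
  \<comment> \<open>First \<open>c\<^sub>2\<close> bounds only over the whole of \<open>U\<close>.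
    Since \<open>fib\<close> is the same map over \<open>U\<close> and over the smaller arc, its
    fiber class vanishes, and hence it bounds over \<open>W\<^sub>2\<close> as well.\<close>
  have "c\<^sub>2 = field_chain_boundary (Suc p) (zU - d\<^sub>1) + (- e\<^sub>1 - ?g)"
    using d1(3) by (simp add: algebra_simps)
  moreover have "zU - d\<^sub>1 \<in> field_chain_set (Suc p) (part U)"
    using *(1) d1U by (rule field_chain_set_diff)
  moreover have "- e\<^sub>1 - ?g \<in> field_chain_set p (subtopology (part U) E')"
    by (intro field_chain_set_diff field_chain_set_neg e1U *(6))
  ultimately have "c\<^sub>2 \<in> field_relboundary_set p (part U) E'"
    unfolding field_relboundary_iff by blast
  then have "field_chain_map p U.fib c\<^sub>2 \<in> field_relboundary_set p F F'"
    by (rule U.fib_relboundary[OF subset_refl])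
  then have "c\<^sub>2 \<in> field_relboundary_set p (part W\<^sub>2) E'"
    by (rule boundary_if_fib[OF overlap_subset(3) contractible(4) base_points(2) *(4)])
  then obtain d\<^sub>2 e\<^sub>2 where d2: "d\<^sub>2 \<in> field_chain_set (Suc p) (part W\<^sub>2)"
    "e\<^sub>2 \<in> field_chain_set p (subtopology (part W\<^sub>2) E')" "c\<^sub>2 = field_chain_boundary (Suc p) d\<^sub>2 + e\<^sub>2"
    unfolding field_relboundary_iff by blast
  have d2U: "d\<^sub>2 \<in> field_chain_set (Suc p) (part U)" and d2V: "d\<^sub>2 \<in> field_chain_set (Suc p) (part V)"
    using d2(1) overlap_subset chain_part_mono by metis+
  have e2U: "e\<^sub>2 \<in> field_chain_set p (subtopology (part U) E')"
    and e2V: "e\<^sub>2 \<in> field_chain_set p (subtopology (part V) E')"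
    using d2(2) overlap_subset chain_part_pair_mono by metis+
  \<comment> \<open>The corrections lie over the overlap, hence over both charts, and cancel in the
    sum \<open>zU' + zV'\<close>.\<close>
  define zU' zV' where "zU' = zU - d\<^sub>1 - d\<^sub>2" and "zV' = zV + d\<^sub>1 + d\<^sub>2"
  have "field_chain_boundary (Suc p) zU' = ?g + e\<^sub>1 + e\<^sub>2"
    using d1(3) d2(3) by (simp add: zU'_def algebra_simps)
  moreover have "zU' \<in> field_chain_set (Suc p) (part U)"
    unfolding zU'_def by (intro field_chain_set_diff *(1) d1U d2U)
  moreover have "?g + e\<^sub>1 + e\<^sub>2 \<in> field_chain_set p (subtopology (part U) E')"
    by (intro field_chain_set_add *(6) e1U e2U)
  ultimately have zU': "zU' \<in> field_relcycle_set (Suc p) (part U) E'"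
    by (simp add: field_relcycle_set_def)
  let ?h = "field_chain_boundary (Suc p) zV + (c\<^sub>1 + c\<^sub>2)"
  have "field_chain_boundary (Suc p) zV' = ?h - e\<^sub>1 - e\<^sub>2"
    using d1(3) d2(3) by (simp add: zV'_def algebra_simps)
  moreover have "zV' \<in> field_chain_set (Suc p) (part V)"
    unfolding zV'_def by (intro field_chain_set_add *(2) d1V d2V)
  moreover have "?h - e\<^sub>1 - e\<^sub>2 \<in> field_chain_set p (subtopology (part V) E')"
    by (intro field_chain_set_diff *(7) e1V e2V)
  ultimately have zV': "zV' \<in> field_relcycle_set (Suc p) (part V) E'"
    by (simp add: field_relcycle_set_def)
  obtain n v where nv: "n \<in> field_relboundary_set (Suc p) E E'" "v \<in> field_relcycle_set (Suc p) F F'"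
    "zU' + zV' = n + field_chain_map (Suc p) (U.sec x) v"
    using chart_cycles_from_fiber[OF zU' zV'] by blast
  have "z = (z - zU - zV) + (zU' + zV')"
    by (simp add: zU'_def zV'_def)
  also have "\<dots> = ((z - zU - zV) + n) + field_chain_map (Suc p) (U.sec x) v"
    by (simp add: nv(3))
  finally show ?thesis
    using field_relboundary_add[OF *(5) nv(1)] nv(2) by blast
qed

end

section \<open>The circle\<close>

text \<open>Stereographic projection onto a line; the vector 1 merely fixes a normal
  direction.\<close>

lemma contractible_punctured_circle:
  assumes "p \<in> sphere (0::complex) 1"
  shows "contractible (sphere 0 1 - {p})"
proof -
  have "(sphere 0 1 - {p}) homeomorphic {x::complex. 1 \<bullet> x = 0}"
    using assms by (intro homeomorphic_punctured_sphere_hyperplane) auto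
  moreover have "contractible {x::complex. 1 \<bullet> x = 0}"
    by (intro convex_imp_contractible convex_hyperplane)
  ultimately show ?thesis
    using homeomorphic_contractible_eq by blast
qed

text \<open>Radial projection retracts a convex cone without the origin onto its unit vectors.
  Intended for half-planes, which cut out the two arcs.\<close>

lemma contractible_sphere_cone:
  fixes H :: "'a::real_normed_vector set"
  assumes "convex H" "0 \<notin> H" and cone: "\<And>z c. z \<in> H \<Longrightarrow> 0 < c \<Longrightarrow> c *\<^sub>R z \<in> H"
  shows "contractible (sphere 0 1 \<inter> H)"
proof (rule retract_of_contractible)
  show "contractible H"
    using assms(1) by (rule convex_imp_contractible)
  have nz: "z \<noteq> 0" if "z \<in> H" for z
    using that assms(2) by blast
  have "retraction H (sphere 0 1 \<inter> H) sgn"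
    unfolding retraction_def
  proof (intro conjI Pi_I ballI)
    show "continuous_on H sgn"
      using nz unfolding sgn_div_norm by (intro continuous_intros) auto
    show "sgn z \<in> sphere 0 1 \<inter> H" if "z \<in> H" for z
      using cone[of z "inverse (norm z)"] nz[OF that] that by (auto simp: norm_sgn sgn_div_norm)
    show "sgn z = z" if "z \<in> sphere 0 1 \<inter> H" for z
      using that by (simp add: sgn_div_norm)
  qed auto
  then show "(sphere 0 1 \<inter> H) retract_of H"
    unfolding retract_of_def by blast
qed

section \<open>Dimensions of homology and the bound for two charts\<close>

lemma homology_dim_eq_basis_modulo:
  obtains T :: "('k::field, 'a) field_chain set"
  where "basis_modulo field_chain_scale (field_relcycle_set k X S) (field_relboundary_set k X S) T"
    "|T| =o homology_dim TYPE('k) (int k) (X :: 'a topology) S"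
proof -
  interpret chain_quotient "field_relcycle_set k X S :: ('k, 'a) field_chain set" "field_relboundary_set k X S"
    by unfold_locales
       (rule subspace_field_relcycle_set subspace_field_relboundary_set field_relboundary_subset_relcycle)+
  obtain T :: "('k, 'a) field_chain set"
    where "basis_modulo field_chain_scale (field_relcycle_set k X S) (field_relboundary_set k X S) T"
    "|T| =o cardinal_dim (field_ring :: 'k ring) Q"
    by (rule cardinal_dim_Q)
  then show thesis
    by (intro that[of T]) (simp_all add: homology_dim_def relative_homology_space_def Q_def)
qed

text \<open>Lets degree 0 pass through the same cardinality bound as the positive degrees, with a
  zero target.\<close>

lemma homology_dim_negative_eq_basis_modulo:
  assumes "p < 0"
  obtains T :: "('k::field, 'a) field_chain set" where "basis_modulo field_chain_scale {0} {0} T"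
    "|T| =o homology_dim TYPE('k) p (X :: 'a topology) S"
proof -
  interpret chain_quotient "{0} :: ('k, 'a) field_chain set" "{0}"
    by unfold_locales simp_all
  obtain T :: "('k, 'a) field_chain set" where "basis_modulo field_chain_scale {0} {0} T"
    "|T| =o cardinal_dim (field_ring :: 'k ring) Q"
    by (rule cardinal_dim_Q)
  with assms show thesis
    by (intro that[of T]) (simp_all add: homology_dim_def relative_homology_space_def Q_def)
qed

lemma linear_field_chain_map:
  "Vector_Spaces.linear field_chain_scale field_chain_scale (field_chain_map p g)"
  unfolding field_chain_map_def by (rule linear_base_change)

context two_chart_pair
begin

lemma homology_dim_le:
  "homology_dim TYPE('k::field) (int k) E E'
    \<le>o homology_dim TYPE('k) (int k) F F' +c homology_dim TYPE('k) (int k - 1) F F'"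
proof -
  obtain T :: "('k, 'a) field_chain set"
    where T: "basis_modulo field_chain_scale (field_relcycle_set k E E') (field_relboundary_set k E E') T"
    "|T| =o homology_dim TYPE('k) (int k) E E'"
    by (rule homology_dim_eq_basis_modulo)
  obtain T\<^sub>0 :: "('k, 'b) field_chain set"
    where T0: "basis_modulo field_chain_scale (field_relcycle_set k F F') (field_relboundary_set k F F') T\<^sub>0"
    "|T\<^sub>0| =o homology_dim TYPE('k) (int k) F F'"
    by (rule homology_dim_eq_basis_modulo)
  let ?i = "field_chain_map k (U.sec x) :: ('k, 'b) field_chain \<Rightarrow> ('k, 'a) field_chain"
  have sec: "?i ` field_relcycle_set k F F' \<subseteq> field_relcycle_set k E E'"
    "?i ` field_relboundary_set k F F' \<subseteq> field_relboundary_set k E E'"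
    using U.sec_relcycle[OF subset_refl overlap_subset(5)] U.sec_relboundary[OF subset_refl overlap_subset(5)]
      field_relcycle_subtopology field_relboundary_subtopology by blast+
  \<comment> \<open>The target of the connecting relation, its basis and the relation itself are
    left open, as they differ between degree 0 and positive degree.\<close>
  note bound = card_of_basis_modulo_le_sum[OF chain.vector_space_axioms chain.vector_space_axioms
    subspace_field_relcycle_set subspace_field_relboundary_set field_relboundary_subset_relcycle
    subspace_field_relcycle_set _ T(1) T0(1) _ linear_field_chain_map sec]
  obtain T\<^sub>1 :: "('k, 'b) field_chain set"
    where T1: "|T\<^sub>1| =o homology_dim TYPE('k) (int k - 1) F F'" "|T| \<le>o |T\<^sub>0| +c |T\<^sub>1|"
  proof (cases k)
    case 0
    obtain T\<^sub>1 :: "('k, 'b) field_chain set" where T1: "basis_modulo field_chain_scale {0} {0} T\<^sub>1"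
      "|T\<^sub>1| =o homology_dim TYPE('k) (int k - 1) F F'"
      using 0 by (rule_tac homology_dim_negative_eq_basis_modulo[of "int k - 1"]) simp_all
    \<comment> \<open>In degree 0 every chain is a relative cycle, so the pieces over the charts
      come from the fiber at once and no connecting map is needed.\<close>
    have fiber: "\<exists>n\<in>field_relboundary_set k E E'. \<exists>y\<in>field_relcycle_set k F F'.
        z = n + field_chain_map k (U.sec x) y" if z: "z \<in> field_relcycle_set k E E'"
      for z :: "('k, 'a) field_chain"
    proof -
      obtain zU zV where zUV: "zU \<in> field_chain_set k (part U)" "zV \<in> field_chain_set k (part V)"
        "z - zU - zV \<in> field_relboundary_set k E E'"
        using relcycle_splits[OF z] .
      then have "zU \<in> field_relcycle_set k (part U) E'" "zV \<in> field_relcycle_set k (part V) E'"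
        using 0 by (simp_all add: field_relcycle_set_def field_chain_boundary_def field_chain_set_0)
      then obtain n w where nw: "n \<in> field_relboundary_set k E E'" "w \<in> field_relcycle_set k F F'"
        "zU + zV = n + field_chain_map k (U.sec x) w"
        using chart_cycles_from_fiber by blast
      have "z = (z - zU - zV) + (zU + zV)" by simp
      also have "\<dots> = ((z - zU - zV) + n) + field_chain_map k (U.sec x) w"
        by (simp add: nw(3))
      finally show ?thesis
        using field_relboundary_add[OF zUV(3) nw(1)] nw(2) by blast
    qed
    have "|T| \<le>o |T\<^sub>0| +c |T\<^sub>1|"
    \<comment> \<open>The zero map as a relation; its kernel condition is exactly
      \<open>fiber\<close>.\<close>
    proof (rule bound[OF _ T1(1), where R = "\<lambda>z w. z \<in> field_relcycle_set k E E' \<and> w = 0"])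
      show "chain.subspace {0 :: ('k, 'b) field_chain}" by simp
    qed (auto intro: field_relcycle_add chain.subspace_scale[OF subspace_field_relcycle_set] fiber)
    with T1(2) show thesis by (rule that)
  next
    case (Suc j)
    obtain T\<^sub>1 :: "('k, 'b) field_chain set"
      where T1: "basis_modulo field_chain_scale (field_relcycle_set j F F') (field_relboundary_set j F F') T\<^sub>1"
      "|T\<^sub>1| =o homology_dim TYPE('k) (int j) F F'"
      by (rule homology_dim_eq_basis_modulo)
    have "|T| \<le>o |T\<^sub>0| +c |T\<^sub>1|"
      by (rule bound[OF subspace_field_relboundary_set T1(1), where R = "splitting j"])
         (use Suc splitting_add splitting_scale splitting_exists splitting_kernel in auto)
    with T1(2) show thesis
      using that Suc by simp
  qed
  have "homology_dim TYPE('k) (int k) E E' =o |T|"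
    using T(2) by (rule ordIso_symmetric)
  also note T1(2)
  also have "|T\<^sub>0| +c |T\<^sub>1| \<le>o homology_dim TYPE('k) (int k) F F' +c homology_dim TYPE('k) (int k - 1) F F'"
    using T0(2) T1(1) by (intro csum_mono ordIso_imp_ordLeq)
  finally show ?thesis .
qed

end

theorem propositionA1:
  fixes E :: "'a topology" and E\<^sub>0 :: "'b topology" and \<pi> :: "'a \<Rightarrow> complex"
    and E' :: "'a set" and E\<^sub>0' :: "'b set" and k :: nat
  assumes "fiber_bundle E circle \<pi> E\<^sub>0"
    and "E' \<subseteq> topspace E" and "E\<^sub>0' \<subseteq> topspace E\<^sub>0"
    and "\<And>p. p \<in> topspace circle \<Longrightarrow>
           \<exists>\<phi>. trivialization E circle \<pi> E\<^sub>0 (topspace circle - {p}) \<phi> \<and>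
               homeomorphic_map
                 (subtopology E (bundle_preimage E \<pi> (topspace circle - {p}) \<inter> E'))
                 (prod_topology (subtopology circle (topspace circle - {p})) (subtopology E\<^sub>0 E\<^sub>0'))
                 \<phi>"
  shows "homology_dim TYPE('k::field) (int k) E E'
           \<le>o homology_dim TYPE('k) (int k) E\<^sub>0 E\<^sub>0' +c homology_dim TYPE('k) (int k - 1) E\<^sub>0 E\<^sub>0'"
proof -
  \<comment> \<open>Removing the antipodal points 1 and -1 makes the two arcs of the overlap half
    circles, cut out by the sign of the imaginary part, so that
    \<open>contractible_sphere_cone\<close> applies.\<close>
  define U V where "U = sphere (0::complex) 1 - {1}" and "V = sphere (0::complex) 1 - {-1}"
  define W\<^sub>1 W\<^sub>2 where "W\<^sub>1 = sphere (0::complex) 1 \<inter> {z. 0 < Im z}" and "W\<^sub>2 = sphere (0::complex) 1 \<inter> {z. Im z < 0}"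
  obtain \<phi> where \<phi>: "pair_trivialization E circle \<pi> E\<^sub>0 E' E\<^sub>0' U \<phi>"
    using assms(4)[of 1] assms(3) by (auto simp: U_def pair_trivialization_def)
  obtain \<psi> where \<psi>: "pair_trivialization E circle \<pi> E\<^sub>0 E' E\<^sub>0' V \<psi>"
    using assms(4)[of "-1"] assms(3) by (auto simp: V_def pair_trivialization_def)
  \<comment> \<open>Only the two removed points have imaginary part zero, so the half circles
    exhaust the overlap.\<close>
  have real: "z = 1 \<or> z = -1" if "cmod z = 1" "Im z = 0" for z
  proof -
    have "\<bar>Re z\<bar> = 1"
      using that by (simp add: cmod_def)
    then show ?thesis
      using that(2) by (auto simp: complex_eq_iff)
  qed
  have subs: "subtopology circle S = top_of_set S" if "S \<subseteq> sphere 0 1" for S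
    using that by (simp add: subtopology_subtopology Int_absorb1)
  have "two_chart_pair E circle \<pi> E\<^sub>0 E' E\<^sub>0' U \<phi> V \<psi> W\<^sub>1 W\<^sub>2 \<i> (- \<i>)"
  proof (intro two_chart_pair.intro \<phi> \<psi> two_chart_pair_axioms.intro)
    show "continuous_map E circle \<pi>"
      using assms(1) by (simp add: fiber_bundle_def)
    show "topspace circle \<subseteq> U \<union> V"
      by (auto simp: U_def V_def)
    show "U \<inter> V = W\<^sub>1 \<union> W\<^sub>2"
    proof (intro equalityI subsetI)
      fix z assume z: "z \<in> U \<inter> V"
      then have "Im z \<noteq> 0"
        using real[of z] by (auto simp: U_def V_def)
      then show "z \<in> W\<^sub>1 \<union> W\<^sub>2"
        using z by (auto simp: U_def W\<^sub>1_def W\<^sub>2_def)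
    qed (auto simp: U_def V_def W\<^sub>1_def W\<^sub>2_def)
    show "W\<^sub>1 \<inter> W\<^sub>2 = {}"
      by (auto simp: W\<^sub>1_def W\<^sub>2_def)
    show "openin circle W\<^sub>1" "openin circle W\<^sub>2"
      unfolding W\<^sub>1_def W\<^sub>2_def
      by (intro openin_open_Int open_Collect_less continuous_intros)+
    show "\<i> \<in> W\<^sub>1" "- \<i> \<in> W\<^sub>2"
      by (simp_all add: W\<^sub>1_def W\<^sub>2_def)
    show "contractible_space (subtopology circle U)" "contractible_space (subtopology circle V)"
      using contractible_punctured_circle[of 1] contractible_punctured_circle[of "-1"]
      by (simp_all add: subs U_def V_def)
    have "contractible W\<^sub>1"
      unfolding W\<^sub>1_def by (rule contractible_sphere_cone) (auto intro: convex_halfspace_Im_gt)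
    then show "contractible_space (subtopology circle W\<^sub>1)"
      by (simp add: subs W\<^sub>1_def)
    have "contractible W\<^sub>2"
      unfolding W\<^sub>2_def
      by (rule contractible_sphere_cone) (auto intro: convex_halfspace_Im_lt simp: mult_pos_neg)
    then show "contractible_space (subtopology circle W\<^sub>2)"
      by (simp add: subs W\<^sub>2_def)
  qed
  then show ?thesis
    by (rule two_chart_pair.homology_dim_le)
qed

end
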